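(* Let $m\ge 1$, let $G\subset\mathbb{R}^{m+1}$ be a bounded domain with smooth boundary, and let $T(z)=(az+b)(cz+d)^{-1}$ be a M\"obius transformation, with Clifford numbers $a,b,c,d\in\mathcal{C}l_{0m}$ satisfying the constraints listed in the context, which maps $G$ conformally onto a bounded domain $T(G)\subset\mathbb{R}^{m+1}$ with smooth boundary. Then the Szeg\"o metric is invariant under $T$ up to the automorphy factor $|cz+d|^{2m-2}$; that is, for all $z\in G$, $$K_{T(G)}(T(z),T(z))\,|dT(z)| \;=\; |cz+d|^{2m-2}\,K_G(z,z)\,|dz| .$$
   Context: Let $e_1,\dots,e_m$ be the standard basis of $\mathbb{R}^m$ and $\mathcal{C}l_{0m}$ the real Clifford algebra with $e_ie_j+e_je_i=-2\delta_{ij}e_0$, $e_0=1$; its elements are $a=\sum_{A\subseteq\{1,\dots,m\}}a_Ae_A$ with $a_A\in\mathbb{R}$ and $e_A=e_{l_1}\cdots e_{l_r}$ for $A=\{l_1<\dots<l_r\}$, $e_\emptyset=1$. Clifford conjugation $a\mapsto\overline a$ is the anti-automorphism with $\overline{e_j}=-e_j$ for $j\ge1$ and $\overline{1}=1$; reversion $a\mapsto\tilde a$ is the anti-automorphism fixing every $e_j$. $\mathrm{Sc}(a)$ is the coefficient $a_\emptyset$, and $|a|=(\sum_A|a_A|^2)^{1/2}$. $\mathbb{R}^{m+1}$ is identified with the space of paravectors $z=z_0+z_1e_1+\dots+z_me_m$. Put $D=\frac{\partial}{\partial z_0}+\sum_{j=1}^m e_j\frac{\partial}{\partial z_j}$.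 A real differentiable $f:G\to\mathcal{C}l_{0m}$ on an open set $G\subseteq\mathbb{R}^{m+1}$ is left monogenic if $Df=0$ on $G$ (with $D$ acting from the left). The Hardy space $H^2(\partial G,\mathcal{C}l_{0m})$ is the closure, in the $L^2$-norm on $\partial G$, of the set of functions that are left monogenic in $G$ and square integrable on the boundary; its elements are regarded as monogenic functions on $G$. It carries the Clifford-valued inner product $(f,g)=\int_{\partial G}\overline{f(w)}\,g(w)\,dS_w$ ($dS$ = surface measure), norm $\|f\|=\mathrm{Sc}((f,f))^{1/2}$, and satisfies $|f(z)|\le C(z)\|f\|$ for each $z\in G$. The Szeg\"o kernel $K_G$ is its unique reproducing kernel: $f(z)=\int_{\partial G}K_G(z,w)f(w)\,dS_w$ for all $f$ in the Hardy space and $z\in G$, where $\overline{K_G(z,\cdot)}$ lies in the Hardy space. $K_G(z,z)$ is real and positive. The Szeg\"o metric on $G$ is the Hermitian metric with line element $ds_G=K_G(z,z)\,|dz|$. Constraints on $a,b,c,d$: (i) $a,b,c,d$ are products of paravectors from $\mathbb{R}^{m+1}$; (ii) $a\tilde d-b\tilde c=1$; (iii) $ac^{-1},\,c^{-1}d\in\mathbb{R}^{m+1}$ if $c\ne0$, and $bd^{-1}\in\mathbb{R}^{m+1}$ if $c=0$. $|dT(z)|$ denotes the Euclidean line element pulled back by $T$, i.e. $|dT(z)|=\rho(z)|dz|$ with $\rho(z)>0$ the conformal dilation factor of the differential of $T$ at $z$; the displayed identity is an identity of line elements, i.e. of the coefficients of $|dz|$. *)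

theory Defs
  imports "HOL-Analysis.Analysis"
begin

section \<open>The real Clifford algebra of signature (0, m)\<close>

text \<open>
  The generators are indexed by a finite linearly ordered type \<open>'m\<close> with \<open>CARD('m) = m \<ge> 1\<close>.
  An element is the family of its coefficients with respect to the basis \<open>e\<^sub>A\<close>,
  \<open>A \<subseteq> {1..m}\<close>; in particular \<open>norm\<close> is the Euclidean norm of the coefficient family.
\<close>

typedef 'm clifford = "UNIV :: (real ^ ('m::finite set)) set"
  morphisms coeffs Clifford
  by simp

setup_lifting type_definition_clifford

instantiation clifford :: (finite) real_vector
begin
lift_definition zero_clifford :: "'a clifford" is 0 .
lift_definition plus_clifford :: "'a clifford \<Rightarrow> 'a clifford \<Rightarrow> 'a clifford" is "(+)" .
lift_definition minus_clifford :: "'a clifford \<Rightarrow> 'a clifford \<Rightarrow> 'a clifford" is "(-)" .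
lift_definition uminus_clifford :: "'a clifford \<Rightarrow> 'a clifford" is uminus .
lift_definition scaleR_clifford :: "real \<Rightarrow> 'a clifford \<Rightarrow> 'a clifford" is scaleR .
instance by (standard; transfer; simp add: algebra_simps)
end

instantiation clifford :: (finite) real_inner
begin
lift_definition inner_clifford :: "'a clifford \<Rightarrow> 'a clifford \<Rightarrow> real" is inner .
lift_definition norm_clifford :: "'a clifford \<Rightarrow> real" is norm .
definition dist_clifford :: "'a clifford \<Rightarrow> 'a clifford \<Rightarrow> real"
  where "dist_clifford x y = norm (x - y)"
definition sgn_clifford :: "'a clifford \<Rightarrow> 'a clifford"
  where "sgn_clifford x = x /\<^sub>R norm x"
definition uniformity_clifford :: "('a clifford \<times> 'a clifford) filter"
  where "uniformity_clifford = (INF e\<in>{0<..}. principal {(x, y). dist x y < e})"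
definition open_clifford :: "'a clifford set \<Rightarrow> bool"
  where "open_clifford U \<longleftrightarrow> (\<forall>x\<in>U. eventually (\<lambda>(x', y). x' = x \<longrightarrow> y \<in> U) uniformity)"
instance
proof
  fix x y z :: "'a clifford" and r :: real and U :: "'a clifford set"
  show "dist x y = norm (x - y)" by (rule dist_clifford_def)
  show "sgn x = x /\<^sub>R norm x" by (rule sgn_clifford_def)
  show "uniformity = (INF e\<in>{0<..}. principal {(x::'a clifford, y). dist x y < e})"
    by (rule uniformity_clifford_def)
  show "open U = (\<forall>x\<in>U. eventually (\<lambda>(x', y). x' = x \<longrightarrow> y \<in> U) uniformity)"
    by (rule open_clifford_def)
  show "inner x y = inner y x" by transfer (rule inner_commute)
  show "inner (x + y) z = inner x z + inner y z" by transfer (rule inner_add_left)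
  show "inner (r *\<^sub>R x) y = r * inner x y" by transfer simp
  show "0 \<le> inner x x" by transfer simp
  show "(inner x x = 0) = (x = 0)" by transfer simp
  show "norm x = sqrt (inner x x)" by transfer (rule norm_eq_sqrt_inner)
qed
end

instantiation clifford :: (finite) euclidean_space
begin
lift_definition Basis_clifford :: "'a clifford set" is Basis .
instance
proof
  show "(Basis :: 'a clifford set) \<noteq> {}" by transfer simp
  show "finite (Basis :: 'a clifford set)" by transfer simp
  fix u v :: "'a clifford"
  show "u \<in> Basis \<Longrightarrow> v \<in> Basis \<Longrightarrow> inner u v = (if u = v then 1 else 0)"
    by transfer (rule inner_Basis)
  show "(\<forall>u\<in>Basis. inner v u = 0) \<longleftrightarrow> v = 0"
    by transfer (rule euclidean_all_zero_iff)
qed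
end

definition coef :: "'m::finite clifford \<Rightarrow> 'm set \<Rightarrow> real"
  where "coef x A = coeffs x $ A"

lift_definition cbasis :: "'m::finite set \<Rightarrow> 'm clifford" is "\<lambda>A. axis A 1" .

lemma clifford_eq_iff: "x = y \<longleftrightarrow> (\<forall>A. coef x A = coef y A)"
  unfolding coef_def by transfer (simp add: vec_eq_iff)

lemma coef_simps [simp]:
  "coef 0 A = 0" "coef (x + y) A = coef x A + coef y A" "coef (x - y) A = coef x A - coef y A"
  "coef (- x) A = - coef x A" "coef (r *\<^sub>R x) A = r * coef x A"
  unfolding coef_def by (transfer; simp)+

lemma coef_cbasis: "coef (cbasis A) B = (if A = B then 1 else 0)"
  unfolding coef_def by transfer (simp add: axis_def)

lemma norm_clifford_coef: "norm x = sqrt (\<Sum>A\<in>UNIV. (coef x A)\<^sup>2)"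
  unfolding coef_def by transfer (simp add: norm_vec_def L2_set_def)

text \<open>
  \<open>e\<^sub>A e\<^sub>B = cl_sign A B e\<^sub>C\<close> with \<open>C\<close> the symmetric difference: a generator \<open>e\<^sub>j\<close> of \<open>e\<^sub>B\<close> picks up
  one sign from every \<open>e\<^sub>i\<close> of \<open>e\<^sub>A\<close> with \<open>i > j\<close> that it is moved past, and one from \<open>e\<^sub>j e\<^sub>j = -1\<close>
  if \<open>j\<close> lies in \<open>A\<close>.
\<close>

definition cl_sign :: "'m::{finite,linorder} set \<Rightarrow> 'm set \<Rightarrow> real"
  where "cl_sign A B = (\<Prod>i\<in>A. \<Prod>j\<in>B. if j \<le> i then - 1 else 1)"

lemma prod_sign_sym_diff:
  fixes f :: "'a::finite \<Rightarrow> real"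
  assumes "\<And>i. f i * f i = 1"
  shows "prod f (sym_diff A B) = prod f A * prod f B"
proof -
  have A: "prod f A = prod f (A - B) * prod f (A \<inter> B)"
    by (metis finite prod.Int_Diff mult.commute)
  have B: "prod f B = prod f (B - A) * prod f (A \<inter> B)"
    by (metis finite prod.Int_Diff mult.commute Int_commute)
  have "prod f (A \<inter> B) * prod f (A \<inter> B) = 1"
    by (simp add: assms flip: prod.distrib)
  moreover have "prod f (sym_diff A B) = prod f (A - B) * prod f (B - A)"
    by (rule prod.union_disjoint) auto
  ultimately show ?thesis unfolding A B by (simp add: algebra_simps)
qed

lemma cl_sign_square: "cl_sign A B * cl_sign A B = 1"
  unfolding cl_sign_def by (simp flip: prod.distrib add: if_distrib cong: if_cong)

lemma cl_sign_sym_diff_left: "cl_sign (sym_diff A B) C = cl_sign A C * cl_sign B C"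
  unfolding cl_sign_def
  by (rule prod_sign_sym_diff) (simp flip: prod.distrib add: if_distrib cong: if_cong)

lemma cl_sign_sym_diff_right: "cl_sign A (sym_diff B C) = cl_sign A B * cl_sign A C"
  unfolding cl_sign_def
  by (subst prod_sign_sym_diff) (auto simp flip: prod.distrib)

lemma cl_sign_empty [simp]: "cl_sign {} B = 1" "cl_sign A {} = 1"
  by (simp_all add: cl_sign_def)

lemma sym_diff_cancel: "sym_diff A (sym_diff A B) = B"
  by auto

lemma sum_sym_diff: "(\<Sum>B\<in>UNIV. g (sym_diff A B)) = (\<Sum>B\<in>UNIV. g B)"
  for g :: "'m::finite set \<Rightarrow> real"
  by (rule sum.reindex_bij_witness[of _ "sym_diff A" "sym_diff A"]) (auto simp: sym_diff_cancel)

lemma sym_diff_eq_iff: "sym_diff A C = B \<longleftrightarrow> C = sym_diff A B"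
  by auto

instantiation clifford :: ("{finite,linorder}") ring_1
begin
lift_definition one_clifford :: "'a clifford" is "axis {} 1" .
lift_definition times_clifford :: "'a clifford \<Rightarrow> 'a clifford \<Rightarrow> 'a clifford"
  is "\<lambda>x y. \<chi> C. \<Sum>A\<in>UNIV. cl_sign A (sym_diff A C) * (x $ A) * (y $ sym_diff A C)" .

lemma coef_times:
  "coef (x * y) C = (\<Sum>A\<in>UNIV. cl_sign A (sym_diff A C) * coef x A * coef y (sym_diff A C))"
  unfolding coef_def by transfer simp

lemma coef_one: "coef (1 :: 'a clifford) A = (if A = {} then 1 else 0)"
  unfolding coef_def by transfer (simp add: axis_def)

instance
proof
  fix x y z :: "'a clifford"
  show "x * y * z = x * (y * z)"
    unfolding clifford_eq_iff
  proof
    fix D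
    let ?h = "\<lambda>A E. cl_sign E (sym_diff E D) * cl_sign A (sym_diff A E)
                 * coef x A * coef y (sym_diff A E) * coef z (sym_diff E D)"
    have "coef (x * y * z) D = (\<Sum>E\<in>UNIV. \<Sum>A\<in>UNIV. ?h A E)"
      by (simp add: coef_times sum_distrib_left sum_distrib_right mult_ac)
    also have "\<dots> = (\<Sum>A\<in>UNIV. \<Sum>E\<in>UNIV. ?h A E)"
      by (rule sum.swap)
    also have "\<dots> = (\<Sum>A\<in>UNIV. \<Sum>B\<in>UNIV. ?h A (sym_diff A B))"
      by (simp add: sum_sym_diff[where g = "?h _"])
    also have "\<dots> = coef (x * (y * z)) D"
    proof -
      have "?h A (sym_diff A B) = cl_sign A (sym_diff A D) * coef x A *
          (cl_sign B (sym_diff B (sym_diff A D)) * coef y B * coef z (sym_diff B (sym_diff A D)))"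
        for A B
      proof -
        have 1: "sym_diff A (sym_diff A B) = B" by auto
        have 2: "sym_diff (sym_diff A B) D = sym_diff B (sym_diff A D)" by auto
        show ?thesis
          unfolding 1 2 cl_sign_sym_diff_left cl_sign_sym_diff_right
          using cl_sign_square[of A B] by (simp add: algebra_simps)
      qed
      then show ?thesis
        by (simp only: coef_times sum_distrib_left)
    qed
    finally show "coef (x * y * z) D = coef (x * (y * z)) D" .
  qed
  show "1 * x = x"
    unfolding clifford_eq_iff coef_times coef_one
    by (simp add: if_distrib[where f = "\<lambda>t. _ * t"] if_distrib[where f = "\<lambda>t. t * _"] cong: if_cong)
  show "x * 1 = x"
    unfolding clifford_eq_iff
  proof
    fix C
    have "coef (x * 1) C = (\<Sum>A\<in>UNIV. if A = C then coef x C else 0)"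
      unfolding coef_times coef_one
    proof (rule sum.cong)
      fix A
      have "sym_diff A C = {} \<longleftrightarrow> A = C" by auto
      then show "cl_sign A (sym_diff A C) * coef x A * (if sym_diff A C = {} then 1 else 0) =
          (if A = C then coef x C else 0)"
        by (cases "A = C") auto
    qed simp
    then show "coef (x * 1) C = coef x C" by simp
  qed
  show "(x + y) * z = x * z + y * z" "x * (y + z) = x * y + x * z"
    by (simp_all add: clifford_eq_iff coef_times algebra_simps sum.distrib)
  show "(0 :: 'a clifford) \<noteq> 1"
    by (metis clifford_eq_iff coef_one coef_simps(1) zero_neq_one)
qed
end

instance clifford :: ("{finite,linorder}") real_algebra_1
  by standard (simp_all add: clifford_eq_iff coef_times sum_distrib_left mult_ac)

abbreviation gen :: "'m::{finite,linorder} \<Rightarrow> 'm clifford"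
  where "gen j \<equiv> cbasis {j}"

lemma cbasis_empty: "cbasis {} = 1"
  by (simp add: clifford_eq_iff coef_cbasis coef_one)

lemma cbasis_mult: "cbasis A * cbasis B = cl_sign A B *\<^sub>R cbasis (sym_diff A B)"
  unfolding clifford_eq_iff
proof
  fix C
  have "coef (cbasis A * cbasis B) C =
      (\<Sum>E\<in>UNIV. if E = A then cl_sign A (sym_diff A C) * coef (cbasis B) (sym_diff A C) else 0)"
    unfolding coef_times by (rule sum.cong) (auto simp: coef_cbasis)
  also have "\<dots> = cl_sign A (sym_diff A C) * (if B = sym_diff A C then 1 else 0)"
    by (simp add: coef_cbasis)
  also have "\<dots> = cl_sign A B * (if sym_diff A B = C then 1 else 0)"
    using sym_diff_eq_iff[of A C B] by (auto simp: sym_diff_cancel)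
  finally show "coef (cbasis A * cbasis B) C = coef (cl_sign A B *\<^sub>R cbasis (sym_diff A B)) C"
    by (simp add: coef_cbasis)
qed

lemma gen_anticommute:
  "gen i * gen j + gen j * gen i = (if i = j then - 2 else 0)"
proof (cases "i = j")
  case True
  then show ?thesis
    by (simp add: cbasis_mult cl_sign_def cbasis_empty)
next
  case False
  have "sym_diff {i} {j} = sym_diff {j} {i}" by auto
  with False show ?thesis
    by (auto simp: cbasis_mult cl_sign_def)
qed

lemma cbasis_insert_less:
  assumes "\<And>i. i \<in> A \<Longrightarrow> j < i"
  shows "cbasis (insert j A) = gen j * cbasis A"
proof -
  have "j \<notin> A" using assms by auto
  then have "sym_diff {j} A = insert j A" by auto
  moreover have "cl_sign {j} A = 1"
    unfolding cl_sign_def using assms by (auto intro!: prod.neutral simp: not_le)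
  ultimately show ?thesis by (simp add: cbasis_mult)
qed

lemma cbasis_eq_prod_list:
  "sorted_wrt (<) js \<Longrightarrow> cbasis (set js) = prod_list (map gen js)"
proof (induction js)
  case Nil
  then show ?case by (simp add: cbasis_empty)
next
  case (Cons j js)
  then have "sorted_wrt (<) js" "\<And>i. i \<in> set js \<Longrightarrow> j < i" by auto
  then show ?case using Cons.IH cbasis_insert_less[of "set js" j] by simp
qed

definition Sc :: "'m::finite clifford \<Rightarrow> real"
  where "Sc x = coef x {}"

text \<open>Clifford conjugation and reversion are given by their signs on \<open>e\<^sub>A\<close>;
  the lemmas below state that they are the anti-automorphisms with the prescribed values
  on the generators.\<close>

lift_definition conj_cl :: "'m::{finite,linorder} clifford \<Rightarrow> 'm clifford"
  is "\<lambda>x. \<chi> A. (- 1) ^ (card A * (card A + 1) div 2) * x $ A" .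

lift_definition reversion :: "'m::{finite,linorder} clifford \<Rightarrow> 'm clifford"
  is "\<lambda>x. \<chi> A. (- 1) ^ (card A * (card A - 1) div 2) * x $ A" .

lemma coef_conj_cl: "coef (conj_cl x) A = (- 1) ^ (card A * (card A + 1) div 2) * coef x A"
  unfolding coef_def by transfer simp

lemma coef_reversion: "coef (reversion x) A = (- 1) ^ (card A * (card A - 1) div 2) * coef x A"
  unfolding coef_def by transfer simp

lemma cl_sign_self: "cl_sign A A = (- 1) ^ (card A * (card A + 1) div 2)"
proof (induction A rule: finite_linorder_max_induct[OF finite])
  case 1
  then show ?case by simp
next
  case (2 b A)
  have b: "b \<notin> A" using 2 by auto
  have sd: "insert b A = sym_diff {b} A" using b by auto
  have "cl_sign {b} {b} = - 1" by (simp add: cl_sign_def)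
  moreover have "cl_sign A {b} = 1"
    unfolding cl_sign_def using 2 by (auto intro!: prod.neutral simp: not_le)
  moreover have "cl_sign {b} A = (- 1) ^ card A"
  proof -
    have "cl_sign {b} A = (\<Prod>j\<in>A. if j \<le> b then - 1 else 1)"
      by (simp add: cl_sign_def)
    also have "\<dots> = (\<Prod>j\<in>A. - 1)"
      using 2 by (intro prod.cong) (auto simp: less_imp_le)
    finally have "cl_sign {b} A = (\<Prod>j\<in>A. - 1)" .
    then show ?thesis by simp
  qed
  ultimately have "cl_sign (insert b A) (insert b A)
      = - ((- 1) ^ card A * (- 1) ^ (card A * (card A + 1) div 2))"
    unfolding sd cl_sign_sym_diff_left cl_sign_sym_diff_right by (simp add: 2)
  also have "\<dots> = (- 1) ^ (card A + 1 + card A * (card A + 1) div 2)"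
    by (simp add: power_add)
  also have "card A + 1 + card A * (card A + 1) div 2
      = card (insert b A) * (card (insert b A) + 1) div 2"
  proof -
    have "card (insert b A) * (card (insert b A) + 1) = 2 * (card A + 1) + card A * (card A + 1)"
      using b by (simp add: algebra_simps)
    then show ?thesis by simp
  qed
  finally show ?case .
qed

lemma reversion_sign:
  "(- 1) ^ (n * (n - 1) div 2) = (- 1) ^ n * (- 1 :: real) ^ (n * (n + 1) div 2)"
proof (cases n)
  case (Suc k)
  have "n * (n + 1) = 2 * n + n * (n - 1)" using Suc by (simp add: algebra_simps)
  then have "n * (n + 1) div 2 = n + n * (n - 1) div 2" by simp
  then show ?thesis by (simp add: power_add flip: power_mult_distrib)
qed simp

lemma card_sym_diff_sign: "(- 1 :: real) ^ card (sym_diff A B) = (- 1) ^ card A * (- 1) ^ card B"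
  for A B :: "'m::finite set"
  using prod_sign_sym_diff[of "\<lambda>_. - 1" A B] by simp

lemma conj_cl_linear: "conj_cl (x + y) = conj_cl x + conj_cl y" "conj_cl (r *\<^sub>R x) = r *\<^sub>R conj_cl x"
  by (simp_all add: clifford_eq_iff coef_conj_cl algebra_simps)

lemma reversion_linear:
  "reversion (x + y) = reversion x + reversion y" "reversion (r *\<^sub>R x) = r *\<^sub>R reversion x"
  by (simp_all add: clifford_eq_iff coef_reversion algebra_simps)

lemma conj_cl_one: "conj_cl 1 = 1"
  by (simp add: clifford_eq_iff coef_conj_cl coef_one)

lemma reversion_one: "reversion 1 = 1"
  by (simp add: clifford_eq_iff coef_reversion coef_one)

lemma conj_cl_gen: "conj_cl (gen j) = - gen j"
  by (auto simp: clifford_eq_iff coef_conj_cl coef_cbasis)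

lemma reversion_gen: "reversion (gen j) = gen j"
  by (auto simp: clifford_eq_iff coef_reversion coef_cbasis)

lemma anti_mult_aux:
  fixes s :: "'m::{finite,linorder} set \<Rightarrow> real" and f :: "'m clifford \<Rightarrow> 'm clifford"
  assumes f: "\<And>x A. coef (f x) A = s A * coef x A"
    and s: "\<And>A B. s (sym_diff A B) * cl_sign A B = s A * s B * cl_sign B A"
  shows "f (x * y) = f y * f x"
  unfolding clifford_eq_iff
proof
  fix C
  have "coef (f (x * y)) C
      = (\<Sum>A\<in>UNIV. s C * cl_sign A (sym_diff A C) * coef x A * coef y (sym_diff A C))"
    by (simp add: f coef_times sum_distrib_left mult_ac)
  also have "\<dots> = (\<Sum>A\<in>UNIV. s (sym_diff A C) * s A * cl_sign (sym_diff A C) A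
      * coef x A * coef y (sym_diff A C))"
  proof (rule sum.cong)
    fix A
    show "s C * cl_sign A (sym_diff A C) * coef x A * coef y (sym_diff A C)
      = s (sym_diff A C) * s A * cl_sign (sym_diff A C) A * coef x A * coef y (sym_diff A C)"
      using s[of A "sym_diff A C"] by (simp add: sym_diff_cancel mult_ac)
  qed simp
  also have "\<dots> = (\<Sum>B\<in>UNIV. s B * s (sym_diff B C) * cl_sign B (sym_diff B C)
      * coef x (sym_diff B C) * coef y B)"
    by (rule sum.reindex_bij_witness[of _ "\<lambda>B. sym_diff B C" "\<lambda>B. sym_diff B C"])
      (auto simp: Un_Diff Diff_Diff_Int intro!: arg_cong2[where f = "(*)"] arg_cong[where f = s]
         arg_cong[where f = "coef x"] arg_cong2[where f = cl_sign])
  also have "\<dots> = coef (f y * f x) C"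
    by (simp add: f coef_times mult_ac)
  finally show "coef (f (x * y)) C = coef (f y * f x) C" .
qed

lemma conj_cl_mult: "conj_cl (x * y) = conj_cl y * conj_cl x"
proof (rule anti_mult_aux[where f = conj_cl, OF coef_conj_cl])
  fix A B :: "'a set"
  show "(- 1) ^ (card (sym_diff A B) * (card (sym_diff A B) + 1) div 2) * cl_sign A B =
    (- 1) ^ (card A * (card A + 1) div 2) * (- 1) ^ (card B * (card B + 1) div 2) * cl_sign B A"
    unfolding cl_sign_self[symmetric] cl_sign_sym_diff_left cl_sign_sym_diff_right
    using cl_sign_square[of A B] by (simp add: algebra_simps)
qed

lemma reversion_mult: "reversion (x * y) = reversion y * reversion x"
proof (rule anti_mult_aux[where f = reversion, OF coef_reversion])
  fix A B :: "'a set"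
  show "(- 1) ^ (card (sym_diff A B) * (card (sym_diff A B) - 1) div 2) * cl_sign A B =
    (- 1) ^ (card A * (card A - 1) div 2) * (- 1) ^ (card B * (card B - 1) div 2) * cl_sign B A"
    unfolding reversion_sign card_sym_diff_sign
    unfolding cl_sign_self[symmetric] cl_sign_sym_diff_left cl_sign_sym_diff_right
    using cl_sign_square[of A B] by (simp add: algebra_simps)
qed

definition invertible_cl :: "'m::{finite,linorder} clifford \<Rightarrow> bool"
  where "invertible_cl x \<longleftrightarrow> (\<exists>y. x * y = 1 \<and> y * x = 1)"

definition inv_cl :: "'m::{finite,linorder} clifford \<Rightarrow> 'm clifford"
  where "inv_cl x = (THE y. x * y = 1 \<and> y * x = 1)"


section \<open>Paravectors and Moebius transformations\<close>

text \<open>The pair \<open>(z\<^sub>0, (z\<^sub>1, \<dots>, z\<^sub>m))\<close> stands for the point of \<open>\<real>\<^sup>m\<^sup>+\<^sup>1\<close>.\<close>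

type_synonym 'm paravec = "real \<times> (real ^ 'm)"

definition pv :: "'m::{finite,linorder} paravec \<Rightarrow> 'm clifford"
  where "pv z = fst z *\<^sub>R 1 + (\<Sum>j\<in>UNIV. (snd z $ j) *\<^sub>R gen j)"

definition paravectors :: "'m::{finite,linorder} clifford set"
  where "paravectors = range pv"

lemma inj_pv: "inj pv"
proof (rule injI)
  fix x y :: "'a paravec"
  assume eq: "pv x = pv y"
  have lin: "coef (sum f S) A = (\<Sum>j\<in>S. coef (f j) A)"
    for f :: "'a \<Rightarrow> 'a clifford" and S A
    by (induction S rule: infinite_finite_induct) auto
  have 0: "coef (pv z) {} = fst z" for z :: "'a paravec"
    by (simp add: pv_def lin coef_cbasis coef_one)
  have 1: "coef (pv z) {j} = snd z $ j" for z :: "'a paravec" and j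
    by (simp add: pv_def lin coef_cbasis coef_one if_distrib[where f = "\<lambda>t. _ * t"] cong: if_cong)
  show "x = y"
    using eq 0[of x] 0[of y] 1[of x] 1[of y] by (auto simp: prod_eq_iff vec_eq_iff)
qed

definition paravector_products :: "'m::{finite,linorder} clifford set"
  where "paravector_products = {x. \<exists>zs. set zs \<subseteq> paravectors \<and> x = prod_list zs}"

definition moebius_coeffs ::
    "'m::{finite,linorder} clifford \<Rightarrow> 'm clifford \<Rightarrow> 'm clifford \<Rightarrow> 'm clifford \<Rightarrow> bool"
  where "moebius_coeffs a b c d \<longleftrightarrow>
    {a, b, c, d} \<subseteq> paravector_products \<and>
    a * reversion d - b * reversion c = 1 \<and>
    (c \<noteq> 0 \<longrightarrow> a * inv_cl c \<in> paravectors \<and> inv_cl c * d \<in> paravectors) \<and>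
    (c = 0 \<longrightarrow> b * inv_cl d \<in> paravectors)"

text \<open>The value in the Clifford algebra is a paravector under \<open>moebius_coeffs\<close> wherever
  \<open>c z + d\<close> is invertible; \<open>inv pv\<close> reads it as a point of \<open>\<real>\<^sup>m\<^sup>+\<^sup>1\<close>.\<close>

definition moebius_map ::
    "'m::{finite,linorder} clifford \<Rightarrow> 'm clifford \<Rightarrow> 'm clifford \<Rightarrow> 'm clifford
      \<Rightarrow> 'm paravec \<Rightarrow> 'm paravec"
  where "moebius_map a b c d z = inv pv ((a * pv z + b) * inv_cl (c * pv z + d))"

definition has_dilation ::
    "('a::real_normed_vector \<Rightarrow> 'b::real_normed_vector) \<Rightarrow> 'a \<Rightarrow> real \<Rightarrow> bool"
  where "has_dilation f z \<rho> \<longleftrightarrow>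
    0 < \<rho> \<and> (\<exists>f'. (f has_derivative f') (at z) \<and> (\<forall>v. norm (f' v) = \<rho> * norm v))"

definition dilation ::
    "('a::real_normed_vector \<Rightarrow> 'b::real_normed_vector) \<Rightarrow> 'a \<Rightarrow> real"
  where "dilation f z = (THE \<rho>. has_dilation f z \<rho>)"

definition conformal_on ::
    "'a::real_normed_vector set \<Rightarrow> ('a \<Rightarrow> 'b::real_normed_vector) \<Rightarrow> bool"
  where "conformal_on G f \<longleftrightarrow> inj_on f G \<and> (\<forall>z\<in>G. \<exists>\<rho>. has_dilation f z \<rho>)"


section \<open>Bounded domains with smooth boundary, and surface measure\<close>

fun Ck_on :: "nat \<Rightarrow> 'a::euclidean_space set \<Rightarrow> ('a \<Rightarrow> real) \<Rightarrow> bool"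
  where
    "Ck_on 0 U r \<longleftrightarrow> continuous_on U r"
  | "Ck_on (Suc k) U r \<longleftrightarrow> (\<forall>x\<in>U. r differentiable (at x)) \<and>
       (\<forall>v. Ck_on k U (\<lambda>x. frechet_derivative r (at x) v))"

definition smooth_on :: "'a::euclidean_space set \<Rightarrow> ('a \<Rightarrow> real) \<Rightarrow> bool"
  where "smooth_on U r \<longleftrightarrow> (\<forall>k. Ck_on k U r)"

definition smooth_boundary :: "'a::euclidean_space set \<Rightarrow> bool"
  where "smooth_boundary G \<longleftrightarrow> (\<forall>p\<in>frontier G. \<exists>U r.
    open U \<and> p \<in> U \<and> smooth_on U r \<and>
    (\<forall>x\<in>U. \<exists>v. frechet_derivative r (at x) v \<noteq> 0) \<and>
    G \<inter> U = {x\<in>U. r x < 0})"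

definition smooth_bounded_domain :: "'a::euclidean_space set \<Rightarrow> bool"
  where "smooth_bounded_domain G \<longleftrightarrow>
    open G \<and> connected G \<and> G \<noteq> {} \<and> bounded G \<and> smooth_boundary G"

text \<open>Surface measure is the \<open>m\<close>-dimensional Hausdorff measure on the boundary, normalised so that
  it agrees with Lebesgue measure on \<open>m\<close>-dimensional planes.\<close>

definition hausdorff_term :: "nat \<Rightarrow> 'a::euclidean_space set \<Rightarrow> ennreal"
  where "hausdorff_term k C =
    (if C = {} then 0 else ennreal (unit_ball_vol (real k) * (diameter C / 2) ^ k))"

definition hausdorff_delta :: "nat \<Rightarrow> real \<Rightarrow> 'a::euclidean_space set \<Rightarrow> ennreal"
  where "hausdorff_delta k \<delta> A =
    (INF C \<in> {C :: nat \<Rightarrow> 'a set. A \<subseteq> (\<Union>i. C i) \<and> (\<forall>i. bounded (C i) \<and> diameter (C i) \<le> \<delta>)}.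
      \<Sum>i. hausdorff_term k (C i))"

definition hausdorff_outer :: "nat \<Rightarrow> 'a::euclidean_space set \<Rightarrow> ennreal"
  where "hausdorff_outer k A = (SUP \<delta>\<in>{0<..}. hausdorff_delta k \<delta> A)"

definition hausdorff_measure :: "nat \<Rightarrow> 'a::euclidean_space measure"
  where "hausdorff_measure k = measure_of UNIV (sets borel) (hausdorff_outer k)"

definition separated :: "'a::metric_space set \<Rightarrow> 'a set \<Rightarrow> bool"
  where "separated A B \<longleftrightarrow> (\<exists>\<eta>>0. \<forall>x\<in>A. \<forall>y\<in>B. \<eta> \<le> dist x y)"

lemma closed_in_lambda_system:
  fixes f :: "'a::metric_space set \<Rightarrow> ennreal"
  assumes empty: "f {} = 0"
    and mono: "\<And>A B. A \<subseteq> B \<Longrightarrow> f A \<le> f B"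
    and csub: "\<And>A :: nat \<Rightarrow> 'a set. f (\<Union>i. A i) \<le> (\<Sum>i. f (A i))"
    and sep: "\<And>A B. separated A B \<Longrightarrow> f A + f B \<le> f (A \<union> B)"
    and F: "closed F"
  shows "F \<in> lambda_system UNIV UNIV f"
proof -
  have sub2: "f (A \<union> B) \<le> f A + f B" for A B
  proof -
    have "f (\<Union>i::nat. (if i = 0 then A else if i = 1 then B else {}))
        \<le> (\<Sum>i. f (if i = 0 then A else if i = 1 then B else {}))"
      by (rule csub)
    also have "(\<Sum>i. f (if i = 0 then A else if i = 1 then B else {})) =
        (\<Sum>i\<in>{0,1::nat}. f (if i = 0 then A else if i = 1 then B else {}))"
      by (rule suminf_finite) (auto simp: empty)
    also have "\<dots> = f A + f B" by simp
    also have "(\<Union>i::nat. (if i = 0 then A else if i = 1 then B else {})) = A \<union> B"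
      by (auto split: if_splits)
    finally show ?thesis .
  qed
  have ge: "f (F \<inter> X) + f (- F \<inter> X) \<le> f X" for X
  proof (cases "F = {} \<or> f X = top")
    case True
    then show ?thesis by (auto simp: empty)
  next
    case False
    then have Fne: "F \<noteq> {}" and fin: "f X \<noteq> top" by auto
    define t where "t x = infdist x F" for x
    define Y where "Y n = {x\<in>X. 1 / (real n + 1) \<le> t x}" for n
    define R where "R n = {x\<in>X. 1 / (real n + 2) \<le> t x \<and> t x < 1 / (real n + 1)}" for n
    have tlip: "t x \<le> t y + dist x y" for x y
      unfolding t_def by (rule infdist_triangle)
    have t0: "t x = 0 \<longleftrightarrow> x \<in> F" for x
      unfolding t_def using F Fne by (metis in_closed_iff_infdist_zero)
    have tnn: "0 \<le> t x" for x by (simp add: t_def infdist_nonneg)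
    have RX: "R n \<subseteq> X" for n by (auto simp: R_def)
    have sepR: "separated (R j) (R i)" if "i + 2 \<le> j" for i j
      unfolding separated_def
    proof (intro exI[of _ "1 / (real i + 2) - 1 / (real i + 3)"] conjI ballI)
      have "1 / (real i + 3) < 1 / (real i + 2)" by (rule divide_strict_left_mono) auto
      then show "0 < 1 / (real i + 2) - 1 / (real i + 3)" by simp
      fix x y assume x: "x \<in> R j" and y: "y \<in> R i"
      have "1 / (real j + 1) \<le> 1 / (real i + 3)"
        using that by (intro divide_left_mono) auto
      then show "1 / (real i + 2) - 1 / (real i + 3) \<le> dist x y"
        using x y tlip[of y x] unfolding R_def by (auto simp: dist_commute)
    qed
    have bound: "(\<Sum>k<N. f (R (2 * k + p))) \<le> f (\<Union>k<N. R (2 * k + p))" for N p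
    proof (induction N)
      case 0
      then show ?case by (simp add: empty)
    next
      case (Suc N)
      have "separated (R (2 * N + p)) (\<Union>k<N. R (2 * k + p))"
      proof (cases "N = 0")
        case True
        then show ?thesis by (auto simp: separated_def intro: exI[of _ 1])
      next
        case False
        have "\<exists>\<eta>>0. \<forall>x\<in>R (2 * N + p). \<forall>y\<in>R (2 * k + p). \<eta> \<le> dist x y" if "k < N" for k
          using sepR[of "2 * k + p" "2 * N + p"] that unfolding separated_def by auto
        then obtain \<eta> where \<eta>: "\<And>k. k < N \<Longrightarrow> 0 < \<eta> k"
            "\<And>k x y. k < N \<Longrightarrow> x \<in> R (2 * N + p) \<Longrightarrow> y \<in> R (2 * k + p) \<Longrightarrow> \<eta> k \<le> dist x y"
          by metis
        have ne: "\<eta> ` {..<N} \<noteq> {}" using False by auto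
        show ?thesis
          unfolding separated_def
        proof (intro exI[of _ "Min (\<eta> ` {..<N})"] conjI ballI)
          show "0 < Min (\<eta> ` {..<N})" using ne \<eta>(1) by (subst Min_gr_iff) auto
          fix x y assume x: "x \<in> R (2 * N + p)" and "y \<in> (\<Union>k<N. R (2 * k + p))"
          then obtain k where k: "k < N" "y \<in> R (2 * k + p)" by auto
          have "Min (\<eta> ` {..<N}) \<le> \<eta> k" using k by (intro Min_le) auto
          with \<eta>(2)[OF k(1) x k(2)] show "Min (\<eta> ` {..<N}) \<le> dist x y" by simp
        qed
      qed
      then have "f (R (2 * N + p)) + f (\<Union>k<N. R (2 * k + p)) \<le> f (R (2 * N + p) \<union> (\<Union>k<N. R (2 * k + p)))"
        by (rule sep)
      moreover have "R (2 * N + p) \<union> (\<Union>k<N. R (2 * k + p)) = (\<Union>k<Suc N. R (2 * k + p))"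
        by (auto simp: lessThan_Suc)
      ultimately show ?case using Suc by (simp add: add.commute) (meson add_left_mono order_trans)
    qed
    have bound': "(\<Sum>k<N. f (R (2 * k + p))) \<le> f X" for N p
      by (rule order_trans[OF bound mono]) (use RX in blast)
    have half: "(\<Sum>k. f (R (2 * k + p))) \<le> f X" for p
      by (rule suminf_le_const[OF summableI]) (rule bound')
    have tot: "(\<Sum>k<N. f (R k)) \<le> f X + f X" for N
    proof -
      have "(\<Sum>k<N. f (R k)) \<le> (\<Sum>k<2 * N. f (R k))"
        by (rule sum_mono2) auto
      also have "\<dots> = (\<Sum>k<N. f (R (2 * k + 0))) + (\<Sum>k<N. f (R (2 * k + 1)))"
        by (induction N) (auto simp: algebra_simps)
      also have "\<dots> \<le> f X + f X" by (intro add_mono bound')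
      finally show ?thesis .
    qed
    have tail: "(\<lambda>n. \<Sum>k. f (R (k + n))) \<longlonglongrightarrow> 0"
    proof -
      have "(\<Sum>k. f (R k)) \<le> f X + f X"
        by (rule suminf_le_const[OF summableI]) (rule tot)
      then have S: "(\<Sum>k. f (R k)) < top"
        using fin by (metis ennreal_add_eq_top top.not_eq_extremum order_le_less_trans)
      have eq: "(\<Sum>k. f (R (k + n))) = (\<Sum>k. f (R k)) - (\<Sum>k<n. f (R k))" for n
      proof -
        have "(\<Sum>k. f (R k)) = (\<Sum>k. f (R (k + n))) + (\<Sum>k<n. f (R k))"
          by (rule suminf_offset[OF summableI])
        moreover have "(\<Sum>k<n. f (R k)) \<noteq> top"
          using tot[of n] fin by (metis ennreal_add_eq_top neq_top_trans)
        ultimately show ?thesis by (metis ennreal_add_diff_cancel_right)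
      qed
      have "(\<lambda>n. (\<Sum>k. f (R k)) - (\<Sum>k<n. f (R k))) \<longlonglongrightarrow> (\<Sum>k. f (R k)) - (\<Sum>k. f (R k))"
        using S by (intro tendsto_diff_ennreal tendsto_const summable_LIMSEQ summableI) auto
      then show ?thesis unfolding eq using S by simp
    qed
    have step: "f (F \<inter> X) + f (- F \<inter> X) \<le> f X + (\<Sum>k. f (R (k + n)))" for n
    proof -
      have "- F \<inter> X \<subseteq> Y n \<union> (\<Union>k. R (k + n))"
      proof
        fix x assume x: "x \<in> - F \<inter> X"
        then have "0 < t x" using t0[of x] tnn[of x] by auto
        then obtain N where N: "1 / (real N + 1) \<le> t x"
          by (metis add.commute inverse_eq_divide nat_approx_posE less_imp_le of_nat_Suc)
        show "x \<in> Y n \<union> (\<Union>k. R (k + n))"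
        proof (cases "x \<in> Y n")
          case False
          define M where "M = (LEAST N. 1 / (real N + 1) \<le> t x)"
          have M: "1 / (real M + 1) \<le> t x" unfolding M_def by (rule LeastI, rule N)
          have "n < M"
          proof (rule ccontr)
            assume "\<not> n < M"
            then have "1 / (real n + 1) \<le> 1 / (real M + 1)" by (intro divide_left_mono) auto
            with M False x show False by (auto simp: Y_def)
          qed
          then obtain L where L: "M = Suc L" "n \<le> L" by (metis Suc_le_D less_Suc_eq_le Suc_le_eq)
          have "\<not> 1 / (real L + 1) \<le> t x"
            using L not_less_Least[of L "\<lambda>N. 1 / (real N + 1) \<le> t x"] unfolding M_def by auto
          then have "x \<in> R L" using M L x by (auto simp: R_def add.commute)
          then have "x \<in> R ((L - n) + n)" using L by simp
          then show ?thesis by blast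
        qed simp
      qed
      then have "f (- F \<inter> X) \<le> f (Y n) + f (\<Union>k. R (k + n))"
        by (meson mono order_trans sub2)
      also have "\<dots> \<le> f (Y n) + (\<Sum>k. f (R (k + n)))" by (intro add_left_mono csub)
      finally have 1: "f (- F \<inter> X) \<le> f (Y n) + (\<Sum>k. f (R (k + n)))" .
      have "separated (F \<inter> X) (Y n)"
        unfolding separated_def
      proof (intro exI[of _ "1 / (real n + 1)"] conjI ballI)
        fix x y assume "x \<in> F \<inter> X" "y \<in> Y n"
        then show "1 / (real n + 1) \<le> dist x y"
          using tlip[of y x] t0[of x] by (auto simp: Y_def dist_commute)
      qed simp
      then have "f (F \<inter> X) + f (Y n) \<le> f (F \<inter> X \<union> Y n)" by (rule sep)
      also have "\<dots> \<le> f X" by (rule mono) (auto simp: Y_def)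
      finally have 2: "f (F \<inter> X) + f (Y n) \<le> f X" .
      have "f (F \<inter> X) + f (- F \<inter> X) \<le> f (F \<inter> X) + (f (Y n) + (\<Sum>k. f (R (k + n))))"
        by (intro add_left_mono 1)
      also have "\<dots> \<le> f X + (\<Sum>k. f (R (k + n)))"
        using 2 by (metis add.assoc add_right_mono)
      finally show ?thesis .
    qed
    have "(\<lambda>n. f X + (\<Sum>k. f (R (k + n)))) \<longlonglongrightarrow> f X + 0"
      by (intro tendsto_add tendsto_const tail)
    then show ?thesis
      using LIMSEQ_le_const[of _ "f X + 0"] step by simp
  qed
  have "f (F \<inter> X) + f (- F \<inter> X) = f X" for X
  proof (rule antisym[OF ge])
    have "(F \<inter> X) \<union> (- F \<inter> X) = X" by auto
    then show "f X \<le> f (F \<inter> X) + f (- F \<inter> X)" using sub2[of "F \<inter> X" "- F \<inter> X"] by simp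
  qed
  then show ?thesis by (simp add: lambda_system_def Compl_eq_Diff_UNIV)
qed

lemma hausdorff_delta_empty: "0 < \<delta> \<Longrightarrow> hausdorff_delta k \<delta> {} = 0"
  unfolding hausdorff_delta_def
  by (rule antisym[OF INF_lower2[where i = "\<lambda>_. {}"]]) (auto simp: hausdorff_term_def)

lemma hausdorff_delta_mono: "A \<subseteq> B \<Longrightarrow> hausdorff_delta k \<delta> A \<le> hausdorff_delta k \<delta> B"
  unfolding hausdorff_delta_def by (rule INF_superset_mono) auto

lemma hausdorff_delta_antimono: "\<epsilon> \<le> \<delta> \<Longrightarrow> hausdorff_delta k \<delta> A \<le> hausdorff_delta k \<epsilon> A"
  unfolding hausdorff_delta_def by (rule INF_superset_mono) (auto intro: order_trans)

lemma hausdorff_delta_csub: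
  "hausdorff_delta k \<delta> (\<Union>i. A i) \<le> (\<Sum>i. hausdorff_delta k \<delta> (A i))"
proof (cases "(\<Sum>i. hausdorff_delta k \<delta> (A i)) = top")
  case False
  then have fin: "hausdorff_delta k \<delta> (A i) < top" for i
    using ennreal_suminf_lessD[of "\<lambda>i. hausdorff_delta k \<delta> (A i)" top]
    by (simp add: top.not_eq_extremum)
  show ?thesis
  proof (rule ennreal_le_epsilon)
    fix e :: real assume e: "0 < e"
    have "\<exists>C. A i \<subseteq> (\<Union>j. C j) \<and> (\<forall>j. bounded (C j) \<and> diameter (C j) \<le> \<delta>) \<and>
        (\<Sum>j. hausdorff_term k (C j)) \<le> hausdorff_delta k \<delta> (A i) + ennreal (e * (1 / 2) ^ Suc i)"
      for i
    proof -
      have "hausdorff_delta k \<delta> (A i) < hausdorff_delta k \<delta> (A i) + ennreal (e * (1 / 2) ^ Suc i)"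
        using fin[of i] e by (simp add: ennreal_add_left_cancel_less[of _ 0, simplified] top.not_eq_extremum)
      then obtain C where "C \<in> {C. A i \<subseteq> (\<Union>j. C j) \<and> (\<forall>j. bounded (C j) \<and> diameter (C j) \<le> \<delta>)}"
         "(\<Sum>j. hausdorff_term k (C j)) < hausdorff_delta k \<delta> (A i) + ennreal (e * (1 / 2) ^ Suc i)"
        by (subst (asm) hausdorff_delta_def, subst (asm) INF_less_iff) auto
      then show ?thesis by (auto intro: less_imp_le)
    qed
    then obtain C where C: "\<And>i. A i \<subseteq> (\<Union>j. C i j)" "\<And>i j. bounded (C i j)"
        "\<And>i j. diameter (C i j) \<le> \<delta>"
        "\<And>i. (\<Sum>j. hausdorff_term k (C i j))
          \<le> hausdorff_delta k \<delta> (A i) + ennreal (e * (1 / 2) ^ Suc i)"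
      by metis
    define D where "D n = (case prod_decode n of (i, j) \<Rightarrow> C i j)" for n
    have cover: "(\<Union>i. A i) \<subseteq> (\<Union>n. D n)"
    proof
      fix x assume "x \<in> (\<Union>i. A i)"
      then obtain i j where "x \<in> C i j" using C(1) by blast
      then have "x \<in> D (prod_encode (i, j))" by (simp add: D_def)
      then show "x \<in> (\<Union>n. D n)" by blast
    qed
    have "hausdorff_delta k \<delta> (\<Union>i. A i) \<le> (\<Sum>n. hausdorff_term k (D n))"
      unfolding hausdorff_delta_def using cover C
      by (intro INF_lower) (auto simp: D_def split: prod.split)
    also have "\<dots> = (\<Sum>n. (\<lambda>(i, j). hausdorff_term k (C i j)) (prod_decode n))"
      by (simp add: D_def split_beta)
    also have "\<dots> = (\<Sum>i. \<Sum>j. hausdorff_term k (C i j))"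
      using suminf_ennreal_2dimen[of "\<lambda>i. \<Sum>j. hausdorff_term k (C i j)" "\<lambda>(i, j). hausdorff_term k (C i j)"]
      by (simp add: comp_def)
    also have "\<dots> \<le> (\<Sum>i. hausdorff_delta k \<delta> (A i) + ennreal (e * (1 / 2) ^ Suc i))"
      by (intro suminf_le summableI C)
    also have "\<dots> = (\<Sum>i. hausdorff_delta k \<delta> (A i)) + (\<Sum>i. ennreal (e * (1 / 2) ^ Suc i))"
      by (intro suminf_add[symmetric] summableI)
    also have "(\<Sum>i. ennreal (e * (1 / 2) ^ Suc i)) = ennreal e"
    proof (rule suminf_ennreal_eq)
      show "(\<lambda>i. e * (1 / 2) ^ Suc i) sums e"
        using sums_mult[OF power_half_series, of e] by simp
    qed (use e in simp)
    finally show "hausdorff_delta k \<delta> (\<Union>i. A i) \<le> (\<Sum>i. hausdorff_delta k \<delta> (A i)) + ennreal e" .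
  qed
qed simp

lemma hausdorff_outer_empty: "hausdorff_outer k {} = 0"
  unfolding hausdorff_outer_def
  by (rule antisym[OF SUP_least]) (auto simp: hausdorff_delta_empty)

lemma hausdorff_outer_mono: "A \<subseteq> B \<Longrightarrow> hausdorff_outer k A \<le> hausdorff_outer k B"
  unfolding hausdorff_outer_def by (intro SUP_mono) (auto intro: hausdorff_delta_mono)

lemma hausdorff_outer_csub:
  "hausdorff_outer k (\<Union>i. A i) \<le> (\<Sum>i. hausdorff_outer k (A i))"
  unfolding hausdorff_outer_def[of k "\<Union>i. A i"]
proof (rule SUP_least)
  fix \<delta> :: real assume "\<delta> \<in> {0<..}"
  then have "(\<Sum>i. hausdorff_delta k \<delta> (A i)) \<le> (\<Sum>i. hausdorff_outer k (A i))"
    by (intro suminf_le summableI) (auto simp: hausdorff_outer_def intro: SUP_upper)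
  then show "hausdorff_delta k \<delta> (\<Union>i. A i) \<le> (\<Sum>i. hausdorff_outer k (A i))"
    using hausdorff_delta_csub order_trans by blast
qed

lemma hausdorff_outer_separated:
  assumes "separated A B"
  shows "hausdorff_outer k A + hausdorff_outer k B \<le> hausdorff_outer k (A \<union> B)"
proof -
  from assms obtain \<eta> where \<eta>: "0 < \<eta>" "\<And>x y. x \<in> A \<Longrightarrow> y \<in> B \<Longrightarrow> \<eta> \<le> dist x y"
    by (auto simp: separated_def)
  have key: "hausdorff_delta k \<delta> A + hausdorff_delta k \<delta> B \<le> hausdorff_delta k \<delta> (A \<union> B)"
    if "0 < \<delta>" "\<delta> < \<eta>" for \<delta>
    unfolding hausdorff_delta_def[of k \<delta> "A \<union> B"]
  proof (rule INF_greatest)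
    fix C :: "nat \<Rightarrow> 'a set"
    assume "C \<in> {C. A \<union> B \<subseteq> (\<Union>i. C i) \<and> (\<forall>i. bounded (C i) \<and> diameter (C i) \<le> \<delta>)}"
    then have C: "A \<union> B \<subseteq> (\<Union>i. C i)" "\<And>i. bounded (C i)" "\<And>i. diameter (C i) \<le> \<delta>" by auto
    define P where "P i = (if C i \<inter> A = {} then {} else C i)" for i
    define Q where "Q i = (if C i \<inter> A = {} then C i else {})" for i
    have disj: "C i \<inter> A = {} \<or> C i \<inter> B = {}" for i
    proof (rule ccontr)
      assume "\<not> ?thesis"
      then obtain x y where xy: "x \<in> C i" "x \<in> A" "y \<in> C i" "y \<in> B" by auto
      have "dist x y \<le> \<delta>"
        using diameter_bounded_bound[OF C(2) xy(1,3)] C(3)[of i] by simp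
      with \<eta>(2)[OF xy(2,4)] that show False by simp
    qed
    have "A \<subseteq> (\<Union>i. P i)"
    proof
      fix x assume "x \<in> A"
      then obtain i where "x \<in> C i" using C(1) by auto
      with \<open>x \<in> A\<close> have "x \<in> P i" by (auto simp: P_def)
      then show "x \<in> (\<Union>i. P i)" by blast
    qed
    then have P: "hausdorff_delta k \<delta> A \<le> (\<Sum>i. hausdorff_term k (P i))"
      unfolding hausdorff_delta_def using C that by (intro INF_lower) (auto simp: P_def)
    have "B \<subseteq> (\<Union>i. Q i)"
    proof
      fix x assume "x \<in> B"
      then obtain i where "x \<in> C i" using C(1) by auto
      with \<open>x \<in> B\<close> disj[of i] have "x \<in> Q i" by (auto simp: Q_def)
      then show "x \<in> (\<Union>i. Q i)" by blast
    qed
    then have Q: "hausdorff_delta k \<delta> B \<le> (\<Sum>i. hausdorff_term k (Q i))"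
      unfolding hausdorff_delta_def using C that by (intro INF_lower) (auto simp: Q_def)
    have "(\<Sum>i. hausdorff_term k (P i)) + (\<Sum>i. hausdorff_term k (Q i))
        = (\<Sum>i. hausdorff_term k (P i) + hausdorff_term k (Q i))"
      by (intro suminf_add summableI)
    also have "\<dots> = (\<Sum>i. hausdorff_term k (C i))"
      by (intro suminf_cong) (auto simp: P_def Q_def hausdorff_term_def)
    finally show "hausdorff_delta k \<delta> A + hausdorff_delta k \<delta> B \<le> (\<Sum>i. hausdorff_term k (C i))"
      using add_mono[OF P Q] by simp
  qed
  have "hausdorff_outer k A + hausdorff_outer k B
      = (SUP \<delta>\<in>{0<..}. hausdorff_delta k \<delta> A + hausdorff_delta k \<delta> B)"
    unfolding hausdorff_outer_def
  proof (rule SUP_add_directed_ennreal[symmetric])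
    fix \<delta> \<epsilon> :: real assume "\<delta> \<in> {0<..}" "\<epsilon> \<in> {0<..}"
    then show "\<exists>r\<in>{0<..}. hausdorff_delta k \<delta> A + hausdorff_delta k \<epsilon> B
        \<le> hausdorff_delta k r A + hausdorff_delta k r B"
      by (intro bexI[of _ "min \<delta> \<epsilon>"] add_mono hausdorff_delta_antimono) auto
  qed
  also have "\<dots> \<le> hausdorff_outer k (A \<union> B)"
  proof (rule SUP_least)
    fix \<delta> :: real assume \<delta>: "\<delta> \<in> {0<..}"
    define r where "r = min \<delta> (\<eta> / 2)"
    have r: "0 < r" "r < \<eta>" "r \<le> \<delta>" using \<delta> \<eta>(1) by (auto simp: r_def)
    have "hausdorff_delta k \<delta> A + hausdorff_delta k \<delta> B \<le> hausdorff_delta k r A + hausdorff_delta k r B"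
      by (intro add_mono hausdorff_delta_antimono r)
    also have "\<dots> \<le> hausdorff_delta k r (A \<union> B)" by (rule key[OF r(1,2)])
    also have "\<dots> \<le> hausdorff_outer k (A \<union> B)"
      unfolding hausdorff_outer_def using r by (intro SUP_upper) auto
    finally show "hausdorff_delta k \<delta> A + hausdorff_delta k \<delta> B \<le> hausdorff_outer k (A \<union> B)" .
  qed
  finally show ?thesis .
qed

lemma emeasure_hausdorff_measure:
  fixes A :: "'a::euclidean_space set"
  assumes "A \<in> sets borel"
  shows "emeasure (hausdorff_measure k) A = hausdorff_outer k A"
proof -
  let ?f = "hausdorff_outer k :: 'a set \<Rightarrow> ennreal"
  interpret U: sigma_algebra "UNIV :: 'a set" UNIV
    using sigma_algebra_Pow[of "UNIV :: 'a set"] by simp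
  have oms: "outer_measure_space UNIV ?f"
    unfolding outer_measure_space_def positive_def increasing_def countably_subadditive_def
    by (auto simp: hausdorff_outer_empty intro: hausdorff_outer_mono hausdorff_outer_csub)
  have ms: "measure_space UNIV (lambda_system UNIV UNIV ?f) ?f"
    by (rule U.caratheodory_lemma[OF oms])
  then have sa: "sigma_algebra UNIV (lambda_system UNIV UNIV ?f)"
    by (simp add: measure_space_def)
  have "sets borel = sigma_sets UNIV (Collect closed :: 'a set set)"
    by (simp add: borel_eq_closed)
  also have "\<dots> \<subseteq> lambda_system UNIV UNIV ?f"
    by (rule sigma_algebra.sigma_sets_subset[OF sa])
      (auto intro!: closed_in_lambda_system hausdorff_outer_empty hausdorff_outer_mono
        hausdorff_outer_csub hausdorff_outer_separated)
  finally have sub: "sets borel \<subseteq> lambda_system UNIV UNIV ?f" .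
  have ca: "countably_additive (sets borel) ?f" and pos: "positive (sets borel) ?f"
    using ms sub unfolding measure_space_def countably_additive_def positive_def by blast+
  have sp: "sets (hausdorff_measure k :: 'a measure) = sets borel"
    unfolding hausdorff_measure_def by (metis sets.sigma_sets_eq sets_measure_of space_borel top_greatest Pow_UNIV)
  show ?thesis
    by (rule emeasure_measure_of[OF hausdorff_measure_def])
      (use assms pos ca sp in auto)
qed

lemma sets_hausdorff_measure: "sets (hausdorff_measure k :: 'a::euclidean_space measure) = sets borel"
  unfolding hausdorff_measure_def by (metis sets.sigma_sets_eq sets_measure_of space_borel top_greatest Pow_UNIV)

definition surface_measure :: "'m::finite paravec set \<Rightarrow> 'm paravec measure"
  where "surface_measure G = restrict_space (hausdorff_measure CARD('m)) (frontier G)"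


section \<open>Monogenic functions, Hardy space and Szegoe kernel\<close>

definition dirac ::
    "('m::{finite,linorder} paravec \<Rightarrow> 'm clifford) \<Rightarrow> 'm paravec \<Rightarrow> 'm clifford"
  where "dirac f z = frechet_derivative f (at z) (1, 0)
    + (\<Sum>j\<in>UNIV. gen j * frechet_derivative f (at z) (0, axis j 1))"

definition left_monogenic ::
    "'m::{finite,linorder} paravec set \<Rightarrow> ('m paravec \<Rightarrow> 'm clifford) \<Rightarrow> bool"
  where "left_monogenic G f \<longleftrightarrow> (\<forall>z\<in>G. f differentiable (at z) \<and> dirac f z = 0)"

definition hardy_inner ::
    "'m::{finite,linorder} paravec set \<Rightarrow> ('m paravec \<Rightarrow> 'm clifford) \<Rightarrow> ('m paravec \<Rightarrow> 'm clifford)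
      \<Rightarrow> 'm clifford"
  where "hardy_inner G f g = (\<integral>w. conj_cl (f w) * g w \<partial>surface_measure G)"

definition hardy_norm ::
    "'m::{finite,linorder} paravec set \<Rightarrow> ('m paravec \<Rightarrow> 'm clifford) \<Rightarrow> real"
  where "hardy_norm G f = sqrt (Sc (hardy_inner G f f))"

definition square_integrable ::
    "'m::{finite,linorder} paravec set \<Rightarrow> ('m paravec \<Rightarrow> 'm clifford) \<Rightarrow> bool"
  where "square_integrable G f \<longleftrightarrow> f \<in> borel_measurable (surface_measure G) \<and>
    integrable (surface_measure G) (\<lambda>w. (norm (f w))\<^sup>2)"

text \<open>The boundary values of the functions whose closure is taken are those of the continuous
  extension to the closed domain.\<close>

definition hardy_core ::
    "'m::{finite,linorder} paravec set \<Rightarrow> ('m paravec \<Rightarrow> 'm clifford) set"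
  where "hardy_core G =
    {f. left_monogenic G f \<and> continuous_on (closure G) f \<and> square_integrable G f}"

text \<open>
  An element of the Hardy space is represented by a function \<open>F\<close> on the closed domain: on the
  boundary \<open>F\<close> represents the \<open>L\<^sup>2\<close>-class, and inside \<open>F\<close> is the monogenic function attached to
  it.  As \<open>norm (f z) \<le> C z * hardy_norm G f\<close> on \<open>hardy_core G\<close>, the interior values are the limits
  of those of any approximating sequence, and they depend only on the boundary class.
\<close>

definition hardy_space ::
    "'m::{finite,linorder} paravec set \<Rightarrow> ('m paravec \<Rightarrow> 'm clifford) set"
  where "hardy_space G = {F. left_monogenic G F \<and> square_integrable G F \<and>
    (\<exists>f. (\<forall>n. f n \<in> hardy_core G) \<and>
      (\<lambda>n. hardy_norm G (\<lambda>w. f n w - F w)) \<longlonglongrightarrow> 0 \<and>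
      (\<forall>z\<in>G. (\<lambda>n. f n z) \<longlonglongrightarrow> F z))}"

definition is_szego_kernel ::
    "'m::{finite,linorder} paravec set \<Rightarrow> ('m paravec \<Rightarrow> 'm paravec \<Rightarrow> 'm clifford) \<Rightarrow> bool"
  where "is_szego_kernel G K \<longleftrightarrow> (\<forall>z\<in>G.
    (\<lambda>w. conj_cl (K z w)) \<in> hardy_space G \<and>
    (\<forall>f\<in>hardy_space G. f z = (\<integral>w. K z w * f w \<partial>surface_measure G)))"

lemma conj_cl_conj_cl [simp]: "conj_cl (conj_cl x) = x"
  by (simp add: clifford_eq_iff coef_conj_cl flip: mult.assoc power_mult_distrib)

lemma bounded_linear_conj_cl: "bounded_linear conj_cl"
  by (intro linear_conv_bounded_linear[THEN iffD1] linearI conj_cl_linear)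

lemma szego_kernel_unique:
  assumes K: "is_szego_kernel G K" and L: "is_szego_kernel G L" and z: "z \<in> G" and w: "w \<in> G"
  shows "K z w = L z w"
proof -
  have swap: "K u v = conj_cl (L v u)"
    if K: "is_szego_kernel G K" and L: "is_szego_kernel G L" and "u \<in> G" "v \<in> G" for u v K L
  proof -
    have "conj_cl (K u v) = (\<integral>x. L v x * conj_cl (K u x) \<partial>surface_measure G)"
    proof -
      have "(\<lambda>x. conj_cl (K u x)) \<in> hardy_space G"
        using K that unfolding is_szego_kernel_def by blast
      moreover have "\<forall>f\<in>hardy_space G. f v = (\<integral>x. L v x * f x \<partial>surface_measure G)"
        using L that unfolding is_szego_kernel_def by blast
      ultimately show ?thesis by (rule bspec[rotated])
    qed
    also have "\<dots> = (\<integral>x. conj_cl (K u x * conj_cl (L v x)) \<partial>surface_measure G)"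
      by (simp add: conj_cl_mult)
    also have "\<dots> = conj_cl (\<integral>x. K u x * conj_cl (L v x) \<partial>surface_measure G)"
      by (rule integral_bounded_linear'[OF bounded_linear_conj_cl bounded_linear_conj_cl]) simp
    also have "(\<integral>x. K u x * conj_cl (L v x) \<partial>surface_measure G) = conj_cl (L v u)"
    proof -
      have "(\<lambda>x. conj_cl (L v x)) \<in> hardy_space G"
        using L that unfolding is_szego_kernel_def by blast
      moreover have "\<forall>f\<in>hardy_space G. f u = (\<integral>x. K u x * f x \<partial>surface_measure G)"
        using K that unfolding is_szego_kernel_def by blast
      ultimately have "conj_cl (L v u) = (\<integral>x. K u x * conj_cl (L v x) \<partial>surface_measure G)"
        by (rule bspec[rotated])
      then show ?thesis by simp
    qed
    finally show ?thesis by (metis conj_cl_conj_cl)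
  qed
  show ?thesis
    using swap[OF K L z w] swap[OF L L z w] by simp
qed

text \<open>By the preceding lemma the choice is immaterial on \<open>G \<times> G\<close>; 0 is only the conventional
  value for sets that have no kernel.\<close>

definition szego_kernel ::
    "'m::{finite,linorder} paravec set \<Rightarrow> 'm paravec \<Rightarrow> 'm paravec \<Rightarrow> 'm clifford"
  where "szego_kernel G =
    (if \<exists>K. is_szego_kernel G K then (SOME K. is_szego_kernel G K) else (\<lambda>_ _. 0))"

text \<open>The coefficient of \<open>|dz|\<close> in the line element; \<open>Sc\<close> reads the Clifford-valued kernel
  on the diagonal as a real number.\<close>

definition szego_metric :: "'m::{finite,linorder} paravec set \<Rightarrow> 'm paravec \<Rightarrow> real"
  where "szego_metric G z = Sc (szego_kernel G z z)"

end

theory Submission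
  imports Defs
begin

text \<open>
  Put \<open>q z = c z + d\<close> and \<open>J z = conj (q z) / |q z| ^ (m + 1)\<close>.  As \<open>q z\<close> is a product of
  paravectors, left and right multiplication by it are similarities, and
  \<open>T z - T w = (reversion (q w))\<^sup>-\<^sup>1 (z - w) (q z)\<^sup>-\<^sup>1\<close>.  Hence \<open>T\<close> has dilation
  \<open>1 / |q z|\<^sup>2\<close> and multiplies surface measure by \<open>|J z|\<^sup>2\<close>, while
  \<open>D (J f \<circ> T) = |q| ^ (- m - 3) (reversion q) ((D f) \<circ> T)\<close>.  So \<open>f \<mapsto> J f \<circ> T\<close> is an isometry
  from the Hardy space of \<open>T G\<close> onto that of \<open>G\<close>, which turns a Szegoe kernel \<open>K\<close> of \<open>G\<close> into the
  kernel \<open>(J z)\<^sup>-\<^sup>1 K z w (conj (J w))\<^sup>-\<^sup>1\<close> at \<open>(T z, T w)\<close>.  On the diagonal \<open>Sc (x y) = Sc (y x)\<close>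
  leaves the factor \<open>|J z|\<^sup>-\<^sup>2 = |q z| ^ (2 m)\<close>.
\<close>

section \<open>Versors\<close>

text \<open>For m at least 3 the algebra has zero divisors and its norm is not multiplicative, so
  the calculus is confined to products of nonzero paravectors. The factor \<open>J\<close> comes
  from the Cauchy kernel: for \<open>c\<close> nonzero, q z = c (z + x0) with x0 = c^-1 d, so
  \<open>J\<close> is conj x / |x|^(m+1) at x = z + x0, times a constant on the right. This makes
  \<open>J\<close> monogenic, while |J|^2 = |q|^(-2m) is the Jacobian of \<open>T\<close> for
  m-dimensional measure. Surface measure is transported without charts, because the formula for T z
  - T w gives an exact identity for distances between any two points. Existence of a kernel is not
  established: kernels transport in both directions, so either both domains have one or neither has.
  The exponent 2m - 2 is 2m from the kernel less 2 from the dilation.\<close>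

lemma bounded_bilinear_clifford_mult:
  "bounded_bilinear ((*) :: 'm::{finite,linorder} clifford \<Rightarrow> 'm clifford \<Rightarrow> 'm clifford)"
  unfolding bilinear_conv_bounded_bilinear[symmetric] bilinear_def
  by (auto intro!: linearI simp: algebra_simps)

lemma inner_clifford_coef: "inner x y = (\<Sum>A\<in>UNIV. coef x A * coef y A)"
  unfolding coef_def by transfer (simp add: inner_vec_def)

lemma Sc_add: "Sc (x + y) = Sc x + Sc y" and Sc_scaleR: "Sc (r *\<^sub>R x) = r * Sc x"
  and Sc_one: "Sc 1 = 1"
  by (simp_all add: Sc_def coef_one)

lemma Sc_mult: "Sc (x * y) = (\<Sum>A\<in>UNIV. cl_sign A A * coef x A * coef y A)"
  by (simp add: Sc_def coef_times)

text \<open>Only pairs of equal index sets reach the coefficient of the unit, so \<open>Sc\<close>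
  acts as a trace. This cyclicity stands in for commutativity in the norm and kernel
  computations.\<close>

lemma Sc_mult_commute: "Sc (x * y) = Sc (y * x)"
  by (simp add: Sc_mult mult_ac)

text \<open>\<open>cl_sign A A\<close> is both the sign in the square of the basis element and the
  sign of conjugation on it; the two cancel.\<close>

lemma Sc_conj_mult: "Sc (conj_cl x * y) = inner x y"
  unfolding Sc_mult inner_clifford_coef coef_conj_cl cl_sign_self[symmetric]
  by (simp add: cl_sign_square flip: mult.assoc)

lemma Sc_mult_conj: "Sc (x * conj_cl y) = inner x y"
  by (metis Sc_conj_mult Sc_mult_commute inner_commute)

lemma reversion_reversion [simp]: "reversion (reversion x) = x"
  and conj_cl_zero [simp]: "conj_cl 0 = 0"
  and reversion_zero [simp]: "reversion 0 = 0"
  by (simp_all add: clifford_eq_iff coef_conj_cl coef_reversion flip: mult.assoc power_mult_distrib)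

lemma norm_conj_cl [simp]: "norm (conj_cl x) = norm x"
  and norm_reversion [simp]: "norm (reversion x) = norm x"
  by (simp_all add: norm_clifford_coef coef_conj_cl coef_reversion power_mult_distrib
      flip: power_mult)

lemma inv_cl_eqI: "x * y = 1 \<Longrightarrow> y * x = 1 \<Longrightarrow> inv_cl x = y"
  unfolding inv_cl_def
  by (rule the_equality) (auto, metis mult.assoc mult_1_left mult_1_right)

section \<open>The embedding of paravectors and the polarised Clifford relations\<close>

lemma pv_linear: "pv (x + y) = pv x + pv y" "pv (r *\<^sub>R x) = r *\<^sub>R pv x"
  by (simp_all add: pv_def algebra_simps sum.distrib scaleR_sum_right)

lemma linear_pv: "linear pv"
  by (intro linearI pv_linear)

lemma pv_zero [simp]: "pv 0 = 0" and pv_diff: "pv (x - y) = pv x - pv y"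
  and pv_sum: "pv (sum f S) = (\<Sum>i\<in>S. pv (f i))"
  by (simp_all add: linear_0 linear_diff linear_sum linear_pv)

lemma pv_real: "pv (r, 0) = r *\<^sub>R 1"
  by (simp add: pv_def)

definition pv_conj :: "'m::finite paravec \<Rightarrow> 'm paravec"
  where "pv_conj z = (fst z, - snd z)"

lemma conj_cl_sum: "conj_cl (sum f S) = (\<Sum>i\<in>S. conj_cl (f i))"
  by (induction S rule: infinite_finite_induct) (simp_all add: conj_cl_linear)

lemma conj_cl_pv: "conj_cl (pv z) = pv (pv_conj z)"
  by (simp add: pv_def pv_conj_def conj_cl_linear conj_cl_one conj_cl_sum conj_cl_gen)

lemma reversion_sum: "reversion (sum f S) = (\<Sum>i\<in>S. reversion (f i))"
  by (induction S rule: infinite_finite_induct) (simp_all add: reversion_linear)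

lemma reversion_pv: "reversion (pv z) = pv z"
  by (simp add: pv_def reversion_linear reversion_one reversion_sum reversion_gen)

lemma vector_part_anticommute:
  fixes u v :: "real ^ 'm::{finite,linorder}"
  shows "(\<Sum>i\<in>UNIV. (u $ i) *\<^sub>R gen i) * (\<Sum>j\<in>UNIV. (v $ j) *\<^sub>R gen j)
    + (\<Sum>j\<in>UNIV. (v $ j) *\<^sub>R gen j) * (\<Sum>i\<in>UNIV. (u $ i) *\<^sub>R gen i) = (- 2 * inner u v) *\<^sub>R 1"
proof -
  have *: "gen i * gen j + gen j * gen i = (if i = j then - 2 else 0) *\<^sub>R (1 :: 'm clifford)" for i j
    by (simp add: gen_anticommute scaleR_conv_of_real)
  have "(\<Sum>i\<in>UNIV. (u $ i) *\<^sub>R gen i) * (\<Sum>j\<in>UNIV. (v $ j) *\<^sub>R gen j)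
      + (\<Sum>j\<in>UNIV. (v $ j) *\<^sub>R gen j) * (\<Sum>i\<in>UNIV. (u $ i) *\<^sub>R gen i)
    = (\<Sum>i\<in>UNIV. \<Sum>j\<in>UNIV. (u $ i * v $ j) *\<^sub>R (gen i * gen j))
      + (\<Sum>j\<in>UNIV. \<Sum>i\<in>UNIV. (u $ i * v $ j) *\<^sub>R (gen j * gen i))"
    by (simp add: sum_product mult_ac)
  also have "(\<Sum>j\<in>UNIV. \<Sum>i\<in>UNIV. (u $ i * v $ j) *\<^sub>R (gen j * gen i))
      = (\<Sum>i\<in>UNIV. \<Sum>j\<in>UNIV. (u $ i * v $ j) *\<^sub>R (gen j * gen i))"
    by (rule sum.swap)
  also have "(\<Sum>i\<in>UNIV. \<Sum>j\<in>UNIV. (u $ i * v $ j) *\<^sub>R (gen i * gen j)) + \<dots>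
      = (\<Sum>i\<in>UNIV. \<Sum>j\<in>UNIV. (u $ i * v $ j) *\<^sub>R (gen i * gen j + gen j * gen i))"
    by (simp add: scaleR_add_right sum.distrib)
  also have "\<dots> = (\<Sum>i\<in>UNIV. \<Sum>j\<in>UNIV. (if i = j then - 2 * (u $ i * v $ i) else 0) *\<^sub>R 1)"
    unfolding * by (intro sum.cong refl) auto
  also have "\<dots> = (\<Sum>i\<in>UNIV. (- 2 * (u $ i * v $ i)) *\<^sub>R 1)"
    by (simp add: if_distrib[where f = "\<lambda>t. t *\<^sub>R _"] cong: if_cong)
  also have "\<dots> = (- 2 * inner u v) *\<^sub>R 1"
    by (simp only: inner_vec_def sum_distrib_left scaleR_sum_left inner_real_def)
  finally show ?thesis .
qed

text \<open>Real parts are central and the mixed terms cancel, so only the anticommutator of the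
  vector parts survives. Isometry of \<open>pv\<close>, inverses and the sandwich formula all come
  from this identity.\<close>

lemma pv_mult_conj_polar:
  "pv x * conj_cl (pv y) + pv y * conj_cl (pv x) = (2 * inner x y) *\<^sub>R 1"
proof -
  define X where "X = (\<Sum>i\<in>UNIV. (snd x $ i) *\<^sub>R gen i)"
  define Y where "Y = (\<Sum>i\<in>UNIV. (snd y $ i) *\<^sub>R gen i)"
  have x: "pv x = fst x *\<^sub>R 1 + X" "conj_cl (pv x) = fst x *\<^sub>R 1 - X"
    and y: "pv y = fst y *\<^sub>R 1 + Y" "conj_cl (pv y) = fst y *\<^sub>R 1 - Y"
    unfolding conj_cl_pv by (simp_all add: pv_def pv_conj_def X_def Y_def sum_negf)
  have "pv x * conj_cl (pv y) + pv y * conj_cl (pv x)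
      = (2 * (fst x * fst y)) *\<^sub>R 1 - (X * Y + Y * X)"
    unfolding x(2) y(2) unfolding x(1) y(1) by (simp add: algebra_simps flip: scaleR_2)
  also have "X * Y + Y * X = (- 2 * inner (snd x) (snd y)) *\<^sub>R 1"
    unfolding X_def Y_def by (rule vector_part_anticommute)
  finally show ?thesis
    by (simp add: inner_prod_def algebra_simps)
qed

lemma inner_pv: "inner (pv x) (pv y) = inner x y"
proof -
  have "Sc (pv x * conj_cl (pv y) + pv y * conj_cl (pv x)) = 2 * inner x y"
    unfolding pv_mult_conj_polar by (simp add: Sc_scaleR Sc_one)
  then show ?thesis by (simp add: Sc_add Sc_mult_conj inner_commute)
qed

lemma norm_pv [simp]: "norm (pv x) = norm x"
  by (simp add: norm_eq_sqrt_inner inner_pv)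

lemma pv_mult_conj: "pv x * conj_cl (pv x) = (norm x)\<^sup>2 *\<^sub>R 1"
proof -
  have "2 *\<^sub>R (pv x * conj_cl (pv x)) = 2 *\<^sub>R ((norm x)\<^sup>2 *\<^sub>R 1)"
    using pv_mult_conj_polar[of x x] by (simp add: scaleR_2 power2_norm_eq_inner)
  then show ?thesis by (subst (asm) scaleR_cancel_left) simp
qed

lemma norm_pv_conj [simp]: "norm (pv_conj x) = norm x"
  for x :: "'m::{finite,linorder} paravec"
  using norm_conj_cl[of "pv x"] by (simp only: conj_cl_pv norm_pv)

lemma conj_mult_pv: "conj_cl (pv x) * pv x = (norm x)\<^sup>2 *\<^sub>R 1"
  using pv_mult_conj[of "pv_conj x"]
  by (simp only: conj_cl_pv[symmetric] conj_cl_conj_cl norm_pv_conj)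

text \<open>With w = \<open>pv_conj y\<close>, the polar identity gives x conj(w) x = 2 <x, w> x -
  |x|^2 w, a real combination of paravectors.\<close>

lemma pv_sandwich: "\<exists>y'. pv x * pv y * pv x = pv y'"
proof -
  have "pv x * conj_cl (pv (pv_conj y)) * pv x
      = ((2 * inner x (pv_conj y)) *\<^sub>R 1 - pv (pv_conj y) * conj_cl (pv x)) * pv x"
    by (simp only: pv_mult_conj_polar[symmetric] add_diff_cancel_right')
  also have "\<dots> = pv ((2 * inner x (pv_conj y)) *\<^sub>R x - (norm x)\<^sup>2 *\<^sub>R pv_conj y)"
    by (simp add: algebra_simps conj_mult_pv pv_linear pv_diff)
  finally show ?thesis unfolding conj_cl_pv[symmetric] conj_cl_conj_cl by blast
qed

text \<open>The group generated by the nonzero paravectors (Lipschitz group). In contrast to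
  \<open>paravector_products\<close>, zero factors are excluded, so every element is
  invertible.\<close>

definition versor :: "'m::{finite,linorder} clifford \<Rightarrow> bool"
  where "versor g \<longleftrightarrow> (\<exists>zs. 0 \<notin> set zs \<and> g = prod_list (map pv zs))"

lemma versor_pv: "x \<noteq> 0 \<Longrightarrow> versor (pv x)"
  unfolding versor_def by (rule exI[of _ "[x]"]) simp

lemma versor_mult: "versor g \<Longrightarrow> versor h \<Longrightarrow> versor (g * h)"
  unfolding versor_def
proof (elim exE conjE)
  fix xs ys :: "'a paravec list"
  assume "0 \<notin> set xs" "g = prod_list (map pv xs)" "0 \<notin> set ys" "h = prod_list (map pv ys)"
  then show "\<exists>zs. 0 \<notin> set zs \<and> g * h = prod_list (map pv zs)"
    by (intro exI[of _ "xs @ ys"]) simp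
qed

lemma versor_induct [consumes 1, case_names one mult]:
  assumes "versor g" and "P 1" and "\<And>x g. x \<noteq> 0 \<Longrightarrow> versor g \<Longrightarrow> P g \<Longrightarrow> P (pv x * g)"
  shows "P g"
proof -
  have "P (prod_list (map pv zs))" if "0 \<notin> set zs" for zs
    using that
  proof (induction zs)
    case (Cons z zs)
    from Cons.prems have z: "z \<noteq> 0" and zs: "0 \<notin> set zs" by auto
    from zs have "versor (prod_list (map pv zs))" unfolding versor_def by (intro exI[of _ zs]) simp
    from assms(3)[OF z this Cons.IH[OF zs]] show ?case by simp
  qed (simp add: assms(2))
  moreover obtain zs where "0 \<notin> set zs" "g = prod_list (map pv zs)"
    using assms(1) unfolding versor_def by (elim exE conjE)
  ultimately show ?thesis by simp
qed

lemma versor_one: "versor 1"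
  unfolding versor_def by (rule exI[of _ "[]"]) simp

lemma versor_reversion: "versor g \<Longrightarrow> versor (reversion g)"
  by (induction rule: versor_induct)
    (simp_all add: reversion_one versor_one reversion_mult reversion_pv versor_mult versor_pv)

lemma versor_conj: "versor g \<Longrightarrow> versor (conj_cl g)"
proof (induction rule: versor_induct)
  case (mult x g)
  have "pv_conj x \<noteq> 0" using mult(1) by (metis norm_pv_conj norm_eq_zero)
  with mult show ?case by (simp add: conj_cl_mult conj_cl_pv versor_mult versor_pv)
qed (simp add: conj_cl_one versor_one)

lemma versor_scaleR:
  assumes "r \<noteq> 0" "versor g" shows "versor (r *\<^sub>R g)"
proof -
  have "versor (pv (r, 0))" using assms by (intro versor_pv) (simp add: zero_prod_def)
  from versor_mult[OF this assms(2)] show ?thesis by (simp add: pv_real)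
qed

text \<open>Each factor x contributes the scalar |x|^2, so both products are the same nonzero scalar
  by induction; applying \<open>Sc\<close> identifies it as |g|^2.\<close>

lemma versor_norm:
  assumes "versor g"
  shows "g * conj_cl g = (norm g)\<^sup>2 *\<^sub>R 1" "conj_cl g * g = (norm g)\<^sup>2 *\<^sub>R 1" "g \<noteq> 0"
proof -
  have "\<exists>s. s \<noteq> 0 \<and> g * conj_cl g = s *\<^sub>R 1 \<and> conj_cl g * g = s *\<^sub>R 1"
    using assms
  proof (induction rule: versor_induct)
    case one
    show ?case by (rule exI[of _ 1]) (simp add: conj_cl_one)
  next
    case (mult x g)
    then obtain s where s: "s \<noteq> 0" "g * conj_cl g = s *\<^sub>R 1" "conj_cl g * g = s *\<^sub>R 1" by blast
    have "pv x * g * conj_cl (pv x * g) = pv x * (g * conj_cl g) * conj_cl (pv x)"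
      by (simp add: conj_cl_mult mult.assoc)
    moreover have "conj_cl (pv x * g) * (pv x * g) = conj_cl g * (conj_cl (pv x) * pv x) * g"
      by (simp add: conj_cl_mult mult.assoc)
    ultimately show ?case
      using s mult(1) by (intro exI[of _ "s * (norm x)\<^sup>2"]) (simp add: pv_mult_conj conj_mult_pv)
  qed
  then obtain s where s: "s \<noteq> 0" "g * conj_cl g = s *\<^sub>R 1" "conj_cl g * g = s *\<^sub>R 1" by blast
  have "inner g g = s"
    using arg_cong[OF s(2), of Sc] by (simp add: Sc_mult_conj Sc_scaleR Sc_one)
  then have "s = (norm g)\<^sup>2" by (simp add: power2_norm_eq_inner)
  with s show "g * conj_cl g = (norm g)\<^sup>2 *\<^sub>R 1" "conj_cl g * g = (norm g)\<^sup>2 *\<^sub>R 1" "g \<noteq> 0" by auto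
qed

lemma inv_cl_versor:
  assumes "versor g"
  shows "inv_cl g = (1 / (norm g)\<^sup>2) *\<^sub>R conj_cl g"
  using versor_norm[OF assms] by (intro inv_cl_eqI) simp_all

lemma versor_inv [simp]:
  assumes "versor g"
  shows "g * inv_cl g = 1" "inv_cl g * g = 1" "inv_cl g * (g * x) = x" "g * (inv_cl g * x) = x"
    "x * inv_cl g * g = x" "x * g * inv_cl g = x"
proof -
  show r: "g * inv_cl g = 1" and l: "inv_cl g * g = 1"
    using versor_norm[OF assms] by (simp_all add: inv_cl_versor assms)
  show "inv_cl g * (g * x) = x" "g * (inv_cl g * x) = x"
    by (simp_all add: l r flip: mult.assoc)
  show "x * inv_cl g * g = x" "x * g * inv_cl g = x"
    by (simp_all add: l r mult.assoc)
qed

lemma versor_inv_cl: "versor g \<Longrightarrow> versor (inv_cl g)"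
  using versor_norm[of g] by (simp add: inv_cl_versor versor_scaleR versor_conj)

lemma norm_inv_cl: "versor g \<Longrightarrow> norm (inv_cl g) = 1 / norm g"
  using versor_norm[of g] by (simp add: inv_cl_versor power2_eq_square)

lemma reversion_inv_cl: "versor g \<Longrightarrow> reversion (inv_cl g) = inv_cl (reversion g)"
  by (rule inv_cl_eqI[symmetric]) (simp_all add: reversion_one flip: reversion_mult)

text \<open>In the trace form conj g and g meet in the middle as a scalar. Multiplication by a
  versor is thus a similarity of the whole algebra.\<close>

lemma inner_versor_mult_left:
  assumes "versor g" shows "inner (g * x) (g * y) = (norm g)\<^sup>2 * inner x y"
proof -
  have "inner (g * x) (g * y) = Sc (conj_cl x * (conj_cl g * g) * y)"
    by (simp only: Sc_conj_mult[symmetric] conj_cl_mult mult.assoc)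
  then show ?thesis using versor_norm[OF assms] by (simp only: mult_scaleR_left mult_scaleR_right mult_1_right Sc_scaleR Sc_conj_mult)
qed

lemma inner_versor_mult_right:
  assumes "versor g" shows "inner (x * g) (y * g) = (norm g)\<^sup>2 * inner x y"
proof -
  have "inner (x * g) (y * g) = Sc (x * (g * conj_cl g) * conj_cl y)"
    by (simp only: Sc_mult_conj[symmetric] conj_cl_mult mult.assoc)
  then show ?thesis using versor_norm[OF assms] by (simp only: mult_scaleR_left mult_scaleR_right mult_1_right Sc_scaleR Sc_mult_conj)
qed

lemma norm_versor_mult_left: "versor g \<Longrightarrow> norm (g * x) = norm g * norm x"
  by (simp add: norm_eq_sqrt_inner[of "g * x"] norm_eq_sqrt_inner[of x] inner_versor_mult_left real_sqrt_mult)

lemma norm_versor_mult_right: "versor g \<Longrightarrow> norm (x * g) = norm x * norm g"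
  by (simp add: norm_eq_sqrt_inner[of "x * g"] norm_eq_sqrt_inner[of x] inner_versor_mult_right real_sqrt_mult)

lemma versor_sandwich: "versor g \<Longrightarrow> g * pv x * reversion g \<in> range pv"
proof (induction arbitrary: x rule: versor_induct)
  case (mult y g)
  then obtain x' where x': "g * pv x * reversion g = pv x'" by (meson rangeE)
  have "pv y * g * pv x * reversion (pv y * g) = pv y * (g * pv x * reversion g) * pv y"
    by (simp add: reversion_mult reversion_pv mult.assoc)
  also obtain y' where "\<dots> = pv y'"
    unfolding x' using pv_sandwich by blast
  finally show ?case by blast
qed (simp add: reversion_one)

lemma versor_paravector_product:
  assumes "x \<in> paravector_products" "x \<noteq> 0" shows "versor x"
proof -
  from assms obtain zs where zs: "set zs \<subseteq> paravectors" "x = prod_list zs"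
    by (auto simp: paravector_products_def)
  have "versor (prod_list zs)" if "set zs \<subseteq> paravectors" "prod_list zs \<noteq> 0" for zs :: "'a clifford list"
    using that
  proof (induction zs)
    case (Cons z zs)
    then obtain u where "z = pv u" by (auto simp: paravectors_def)
    moreover from Cons.prems have "prod_list zs \<noteq> 0" by auto
    ultimately have "versor z" "versor (prod_list zs)" using Cons by (auto intro!: versor_pv)
    then show ?case by (simp add: versor_mult)
  qed (simp add: versor_one)
  with zs assms show ?thesis by blast
qed

section \<open>The Dirac operator\<close>

lemma inv_cl_mult: "versor g \<Longrightarrow> versor h \<Longrightarrow> inv_cl (g * h) = inv_cl h * inv_cl g"
  by (rule inv_cl_eqI) (simp_all add: mult.assoc)

lemma versor_invertible: "versor g \<Longrightarrow> invertible_cl g"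
  unfolding invertible_cl_def by (rule exI[of _ "inv_cl g"]) simp

lemma inv_cl_pv: "x \<noteq> 0 \<Longrightarrow> inv_cl (pv x) = pv ((1 / (norm x)\<^sup>2) *\<^sub>R pv_conj x)"
  by (simp add: inv_cl_versor versor_pv conj_cl_pv pv_linear)

text \<open>Unlike \<open>inv pv\<close>, this left inverse of \<open>pv\<close> is linear.\<close>

lemma adjoint_pv: "adjoint pv (pv x) = x"
proof -
  have "inner (adjoint pv (pv x) - x) y = 0" for y
    by (simp add: inner_diff_left adjoint_works[OF linear_pv] inner_pv inner_commute[of "adjoint pv _"])
      (simp add: inner_commute)
  then show ?thesis by (metis inner_eq_zero_iff right_minus_eq)
qed

lemma bounded_linear_pv: "bounded_linear pv"
  by (simp add: linear_conv_bounded_linear[symmetric] linear_pv)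

lemma bounded_linear_adjoint_pv: "bounded_linear (adjoint pv)"
  by (simp add: linear_conv_bounded_linear[symmetric] adjoint_linear linear_pv)

lemma has_derivative_clifford_mult:
  fixes f g :: "'a::real_normed_vector \<Rightarrow> 'm::{finite,linorder} clifford"
  assumes "(f has_derivative f') (at x within S)" "(g has_derivative g') (at x within S)"
  shows "((\<lambda>x. f x * g x) has_derivative (\<lambda>h. f x * g' h + f' h * g x)) (at x within S)"
  by (rule bounded_bilinear.FDERIV[OF bounded_bilinear_clifford_mult assms])

lemma continuous_on_clifford_mult:
  fixes f g :: "'a::topological_space \<Rightarrow> 'm::{finite,linorder} clifford"
  shows "continuous_on S f \<Longrightarrow> continuous_on S g \<Longrightarrow> continuous_on S (\<lambda>x. f x * g x)"
  by (rule bounded_bilinear.continuous_on[OF bounded_bilinear_clifford_mult])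

text \<open>The derivative of |q| is <q, q' h> / |q|; this extra denominator raises n + 1 to
  \<open>n + 2\<close>, a form free of the truncated \<open>n - 1\<close>.\<close>

lemma has_derivative_inverse_norm_power:
  fixes q :: "'a::real_normed_vector \<Rightarrow> 'b::real_inner"
  assumes q: "(q has_derivative q') (at z)" and nz: "q z \<noteq> 0"
  shows "((\<lambda>z. 1 / norm (q z) ^ n) has_derivative
    (\<lambda>h. - (real n * inner (q z) (q' h) / norm (q z) ^ (n + 2)))) (at z)"
proof -
  have "((\<lambda>z. norm (q z)) has_derivative (\<lambda>h. inner (sgn (q z)) (q' h))) (at z)"
    using has_derivative_compose[OF q has_derivative_norm[OF nz]] by (simp add: inner_commute)
  then have "((\<lambda>z. 1 / norm (q z) ^ n) has_derivative
    (\<lambda>h. - 1 * (inverse (norm (q z) ^ n) * (real n * inner (sgn (q z)) (q' h) * norm (q z) ^ (n - 1)) * inverse (norm (q z) ^ n)))) (at z)"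
    unfolding divide_inverse
    using nz by (auto intro!: derivative_eq_intros simp: field_simps)
  also have "(\<lambda>h. - 1 * (inverse (norm (q z) ^ n) * (real n * inner (sgn (q z)) (q' h) * norm (q z) ^ (n - 1)) * inverse (norm (q z) ^ n)))
     = (\<lambda>h. - (real n * inner (q z) (q' h) / norm (q z) ^ (n + 2)))"
    using nz by (cases n) (auto simp: fun_eq_iff sgn_div_norm field_simps power2_eq_square)
  finally show ?thesis .
qed

text \<open>The basis of \<open>'m paravec\<close> consists of the real unit and the generators, so
  the operator is a uniform sum over an orthonormal basis. This form makes the change of variables
  under \<open>T\<close> accessible.\<close>

lemma dirac_Basis: "dirac f z = (\<Sum>b\<in>Basis. pv b * frechet_derivative f (at z) b)"
proof -
  let ?f = "\<lambda>b. pv b * frechet_derivative f (at z) b"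
  have B: "(Basis :: 'a paravec set) = insert (1, 0) ((\<lambda>j. (0, axis j 1)) ` UNIV)"
    unfolding Basis_prod_def Basis_vec_def by auto
  have inj: "inj (\<lambda>j :: 'a. (0 :: real, axis j (1 :: real)))"
    by (auto intro!: injI simp: axis_eq_axis)
  have "sum ?f Basis = ?f (1, 0) + (\<Sum>j\<in>UNIV. ?f (0, axis j 1))"
    unfolding B by (subst sum.insert) (auto simp: sum.reindex[OF inj])
  moreover have "pv (0, axis j 1) = gen j" for j :: 'a
    by (simp add: pv_def axis_def if_distrib[where f = "\<lambda>t. t *\<^sub>R _"] cong: if_cong)
  ultimately show ?thesis by (simp add: dirac_def pv_real)
qed

lemma dirac_has_derivative:
  "(f has_derivative f') (at z) \<Longrightarrow> dirac f z = (\<Sum>b\<in>Basis. pv b * f' b)"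
  using frechet_derivative_at[of f f' z] by (simp add: dirac_Basis)

lemma sum_Basis_inner_pv: "(\<Sum>b\<in>Basis. inner x b *\<^sub>R pv b) = pv x"
proof -
  have "pv (\<Sum>b\<in>Basis. inner x b *\<^sub>R b) = pv x" by (simp add: euclidean_representation)
  then show ?thesis by (simp only: pv_sum pv_linear)
qed

text \<open>Every summand is 1, and there are m + 1 of them; this count fixes the exponent m + 1 in
  \<open>J\<close>.\<close>

lemma sum_Basis_pv_conj:
  "(\<Sum>b\<in>Basis. pv b * conj_cl (pv b)) = (real (CARD('m) + 1)) *\<^sub>R (1 :: 'm::{finite,linorder} clifford)"
proof -
  have "(\<Sum>b\<in>(Basis :: 'm paravec set). pv b * conj_cl (pv b)) = (\<Sum>b\<in>(Basis :: 'm paravec set). 1)"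
    by (intro sum.cong refl) (simp add: pv_mult_conj)
  then show ?thesis by (simp add: scaleR_conv_of_real)
qed

section \<open>Moebius transformations\<close>

locale moebius =
  fixes a b c d :: "'m::{finite,linorder} clifford"
  assumes coeffs: "moebius_coeffs a b c d"
begin

abbreviation T :: "'m paravec \<Rightarrow> 'm paravec" where "T \<equiv> moebius_map a b c d"

definition q :: "'m paravec \<Rightarrow> 'm clifford" where "q z = c * pv z + d"

definition D :: "'m paravec set" where "D = {z. q z \<noteq> 0}"

definition J :: "'m paravec \<Rightarrow> 'm clifford"
  where "J z = (1 / norm (q z) ^ (CARD('m) + 1)) *\<^sub>R conj_cl (q z)"

section \<open>Normal forms of the map and the two-point formula\<close>

lemma det: "a * reversion d - b * reversion c = 1"
  and products: "a \<in> paravector_products" "b \<in> paravector_products"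
    "c \<in> paravector_products" "d \<in> paravector_products"
  using coeffs by (auto simp: moebius_coeffs_def)

text \<open>Here \<open>q\<close> is the constant \<open>d\<close>, and T z = rev(d)^-1 z d^-1 + p
  is an affine similarity.\<close>

lemma c_zero:
  assumes "c = 0"
  obtains p where "versor d" "a = inv_cl (reversion d)" "b * inv_cl d = pv p"
proof -
  have 1: "a * reversion d = 1" using det assms by simp
  then have d: "versor d" using products by (intro versor_paravector_product) auto
  have "a = (a * reversion d) * inv_cl (reversion d)" by (simp add: d versor_reversion)
  with 1 have a: "a = inv_cl (reversion d)" by simp
  have "b * inv_cl d \<in> paravectors" using coeffs assms by (simp add: moebius_coeffs_def)
  then obtain p where "b * inv_cl d = pv p" by (auto simp: paravectors_def)
  with that d a show thesis by blast
qed

text \<open>Partial fractions: with x0 = c^-1 d the pole is -x0, and p = a c^-1 is the image of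
  infinity, so T z = p - rev(c)^-1 (q z)^-1.\<close>

lemma c_nonzero:
  assumes "c \<noteq> 0"
  obtains x0 p where "versor c" "\<And>z. q z = c * pv (z + x0)"
    "\<And>z. a * pv z + b = pv p * q z - inv_cl (reversion c)"
proof -
  have c: "versor c" using products assms by (intro versor_paravector_product)
  obtain p x0 where p: "a * inv_cl c = pv p" and x0: "inv_cl c * d = pv x0"
    using coeffs assms by (auto simp: moebius_coeffs_def paravectors_def)
  have a: "a = pv p * c" and d: "d = c * pv x0"
    unfolding p[symmetric] x0[symmetric] using c by simp_all
  \<comment> \<open>From d = c x0 follows rev(d) = x0 rev(c), so rev(c) factors out of the
    determinant condition, which then determines \<open>b\<close>.\<close>
  have "(a * pv x0 - b) * reversion c = 1"
    using det unfolding d by (simp add: reversion_mult reversion_pv algebra_simps)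
  then have "(a * pv x0 - b) * reversion c * inv_cl (reversion c) = inv_cl (reversion c)" by simp
  then have "a * pv x0 - b = inv_cl (reversion c)"
    using c by (simp add: versor_reversion)
  then have b: "b = a * pv x0 - inv_cl (reversion c)" by (simp add: algebra_simps)
  have q: "q z = c * pv (z + x0)" for z
    unfolding q_def unfolding d by (simp add: pv_linear algebra_simps)
  have "a * pv z + b = pv p * q z - inv_cl (reversion c)" for z
    unfolding b q unfolding a by (simp add: pv_linear algebra_simps)
  from that[OF c q this] show thesis .
qed

lemma versor_q: assumes "z \<in> D" shows "versor (q z)"
proof (cases "c = 0")
  case True
  then show ?thesis using c_zero by (metis q_def mult_zero_left add_0)
next
  case False
  then obtain x0 where c: "versor c" and q: "q z = c * pv (z + x0)" by (metis c_nonzero)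
  then have "z + x0 \<noteq> 0" using assms by (auto simp: D_def)
  then show ?thesis unfolding q by (intro versor_mult versor_pv c)
qed

lemma D_iff: "z \<in> D \<longleftrightarrow> invertible_cl (q z)"
  using versor_q[of z] versor_invertible by (auto simp: D_def invertible_cl_def)

lemma continuous_on_q: "continuous_on S q"
  unfolding q_def[abs_def]
  by (intro continuous_on_add continuous_on_clifford_mult continuous_on_const
      bounded_linear.continuous_on[OF bounded_linear_pv] continuous_on_id)

lemma open_D: "open D"
proof -
  have "D = q -` (- {0})" by (auto simp: D_def)
  then show ?thesis using open_vimage[OF _ continuous_on_q, of "- {0}"] by (simp add: open_Compl)
qed

lemma has_derivative_q: "(q has_derivative (\<lambda>h. c * pv h)) (at z within S)"
proof -
  have "bounded_linear (\<lambda>h. c * pv h)"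
    by (rule bounded_linear_compose[OF bounded_bilinear.bounded_linear_right[OF bounded_bilinear_clifford_mult] bounded_linear_pv])
  then have "((\<lambda>h. c * pv h) has_derivative (\<lambda>h. c * pv h)) (at z within S)"
    by (rule bounded_linear_imp_has_derivative)
  from has_derivative_add[OF this has_derivative_const[of d]] show ?thesis
    unfolding q_def[abs_def] by simp
qed

lemma inverse_sandwich:
  assumes "versor g" shows "\<exists>y. inv_cl (reversion g) * pv x * inv_cl g = pv y"
  using versor_sandwich[OF versor_inv_cl[OF versor_reversion[OF assms]], of x] assms
  by (auto simp: reversion_inv_cl versor_reversion)

text \<open>\<open>inv pv\<close> is meaningful only on the range of \<open>pv\<close>, so the value
  must first be recognised as a paravector. In both normal forms it is a translation plus or minus a
  sandwiched paravector.\<close>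

lemma pv_T:
  assumes z: "z \<in> D" shows "pv (T z) = (a * pv z + b) * inv_cl (q z)"
proof -
  have "\<exists>y. (a * pv z + b) * inv_cl (q z) = pv y"
  proof (cases "c = 0")
    case True
    then obtain p where p: "versor d" "a = inv_cl (reversion d)" "b * inv_cl d = pv p"
      using c_zero by blast
    obtain y where "inv_cl (reversion d) * pv z * inv_cl d = pv y"
      using inverse_sandwich[OF p(1)] by blast
    moreover have "q z = d" unfolding q_def using True by simp
    ultimately have "(a * pv z + b) * inv_cl (q z) = pv (y + p)"
      using p by (simp add: distrib_right pv_linear)
    then show ?thesis ..
  next
    case False
    then obtain x0 p where c: "versor c" and q: "q z = c * pv (z + x0)"
      and ab: "a * pv z + b = pv p * q z - inv_cl (reversion c)" by (metis c_nonzero)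
    have x: "z + x0 \<noteq> 0" using q z by (auto simp: D_def)
    obtain y where y: "inv_cl (pv (z + x0)) = pv y" using inv_cl_pv[OF x] by blast
    have "inv_cl (q z) = pv y * inv_cl c"
      unfolding q using inv_cl_mult[OF c versor_pv[OF x]] y by simp
    moreover obtain u where "inv_cl (reversion c) * pv y * inv_cl c = pv u"
      using inverse_sandwich[OF c] by blast
    ultimately have "inv_cl (reversion c) * inv_cl (q z) = pv u" by (simp add: mult.assoc)
    then have "(a * pv z + b) * inv_cl (q z) = pv (p - u)"
      unfolding ab using versor_q[OF z] by (simp add: left_diff_distrib pv_diff)
    then show ?thesis ..
  qed
  then show ?thesis
    unfolding moebius_map_def q_def[symmetric]
    using f_inv_into_f[of _ pv UNIV] by (metis rangeI)
qed

text \<open>For \<open>c\<close> nonzero the translation p cancels, and (q w)^-1 - (q z)^-1 = (q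
  w)^-1 (q z - q w) (q z)^-1 with q z - q w = c (z - w).\<close>

lemma pv_T_diff:
  assumes z: "z \<in> D" and w: "w \<in> D"
  shows "pv (T z) - pv (T w) = inv_cl (reversion (q w)) * pv (z - w) * inv_cl (q z)"
proof (cases "c = 0")
  case True
  then obtain p where p: "versor d" "a = inv_cl (reversion d)" using c_zero by blast
  have q: "q u = d" for u unfolding q_def using True by simp
  show ?thesis
    unfolding pv_T[OF z] pv_T[OF w] q using p by (simp add: algebra_simps pv_diff)
next
  case False
  then obtain x0 p where c: "versor c" and q: "\<And>z. q z = c * pv (z + x0)"
      and ab: "\<And>z. a * pv z + b = pv p * q z - inv_cl (reversion c)" using c_nonzero by blast
  have x: "w + x0 \<noteq> 0" using q[of w] w by (auto simp: D_def)
  have eq: "pv (T u) = pv p - inv_cl (reversion c) * inv_cl (q u)" if "u \<in> D" for u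
    unfolding pv_T[OF that] ab using versor_q[OF that] by (simp add: left_diff_distrib)
  have "q z - q w = c * pv (z - w)"
    by (simp add: q_def algebra_simps pv_diff)
  moreover have "inv_cl (q w) = inv_cl (pv (w + x0)) * inv_cl c"
    unfolding q using c x by (simp add: inv_cl_mult versor_pv)
  ultimately have "inv_cl (q w) * (q z - q w) = inv_cl (pv (w + x0)) * pv (z - w)"
    using c by (simp add: mult.assoc)
  moreover have "inv_cl (q w) - inv_cl (q z) = inv_cl (q w) * (q z - q w) * inv_cl (q z)"
    using versor_q[OF z] versor_q[OF w] by (simp add: algebra_simps)
  ultimately have *: "inv_cl (q w) - inv_cl (q z) = inv_cl (pv (w + x0)) * pv (z - w) * inv_cl (q z)"
    by simp
  have "pv (T z) - pv (T w) = inv_cl (reversion c) * (inv_cl (q w) - inv_cl (q z))"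
    unfolding eq[OF z] eq[OF w] by (simp add: algebra_simps)
  also have "\<dots> = inv_cl (reversion c) * inv_cl (pv (w + x0)) * pv (z - w) * inv_cl (q z)"
    unfolding * by (simp add: mult.assoc)
  \<comment> \<open>As q w = c (w + x0), reversion swaps the two factors and inversion swaps them
    again.\<close>
  also have "inv_cl (reversion c) * inv_cl (pv (w + x0)) = inv_cl (reversion (q w))"
    unfolding q using c x by (simp add: inv_cl_mult versor_pv versor_reversion reversion_mult reversion_pv)
  finally show ?thesis .
qed

text \<open>Exact for any two points, not only to first order; this is the metric input for the
  change of surface measure.\<close>

lemma dist_T:
  assumes "z \<in> D" "w \<in> D"
  shows "dist (T z) (T w) = (1 / norm (q z)) * (1 / norm (q w)) * dist z w"
proof -
  have "dist (T z) (T w) = norm (pv (T z) - pv (T w))"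
    by (simp add: dist_norm flip: pv_diff)
  then show ?thesis
    using assms by (simp add: pv_T_diff versor_q versor_inv_cl versor_reversion
      norm_versor_mult_left norm_versor_mult_right norm_inv_cl dist_norm)
qed

section \<open>Continuity, derivative and dilation of the map\<close>

lemma continuous_on_T: "continuous_on D T"
proof -
  have "continuous_on D (\<lambda>z. adjoint pv ((a * pv z + b) * ((1 / (norm (q z))\<^sup>2) *\<^sub>R conj_cl (q z))))"
    by (intro bounded_linear.continuous_on[OF bounded_linear_adjoint_pv] continuous_on_clifford_mult
        continuous_intros continuous_on_q bounded_linear.continuous_on[OF bounded_linear_pv]
        bounded_linear.continuous_on[OF bounded_linear_conj_cl]) (auto simp: D_def)
  moreover have "T z = adjoint pv ((a * pv z + b) * ((1 / (norm (q z))\<^sup>2) *\<^sub>R conj_cl (q z)))"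
    if "z \<in> D" for z
    using pv_T[OF that] adjoint_pv[of "T z"] versor_q[OF that] by (simp add: inv_cl_versor)
  ultimately show ?thesis by (subst continuous_on_cong[OF refl]) auto
qed

lemma continuous_on_J: "continuous_on D J"
  unfolding J_def
  by (intro continuous_intros continuous_on_q bounded_linear.continuous_on[OF bounded_linear_conj_cl])
    (auto simp: D_def)

text \<open>For fixed \<open>w\<close>, \<open>pv_T_diff\<close> writes T z - T w as a linear factor
  vanishing at \<open>w\<close> times (q z)^-1. The product rule multiplies the derivative of the
  second factor by 0, so its mere differentiability suffices.\<close>

lemma has_derivative_T:
  assumes w: "w \<in> D"
  obtains T' where "(T has_derivative T') (at w)"
    "\<And>v. pv (T' v) = inv_cl (reversion (q w)) * pv v * inv_cl (q w)"
proof -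
  let ?A = "inv_cl (reversion (q w))"
  let ?Q = "\<lambda>z. (1 / norm (q z) ^ 2) *\<^sub>R conj_cl (q z)"
  have q0: "q w \<noteq> 0" using w by (simp add: D_def)
  have Qw: "?Q z = inv_cl (q z)" if "z \<in> D" for z
    using versor_q[OF that] by (simp add: inv_cl_versor)
  have A: "((\<lambda>z. ?A * pv (z - w)) has_derivative (\<lambda>v. ?A * pv v)) (at w)"
  proof -
  have "bounded_linear (\<lambda>h. ?A * pv h)"
    by (rule bounded_linear_compose[OF bounded_bilinear.bounded_linear_right[OF bounded_bilinear_clifford_mult] bounded_linear_pv])
    from bounded_linear.has_derivative[OF this has_derivative_diff[OF has_derivative_ident has_derivative_const]]
    show ?thesis by simp
  qed
  obtain Q' where Q': "(?Q has_derivative Q') (at w)"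
    using has_derivative_scaleR[OF has_derivative_inverse_norm_power[OF has_derivative_q q0]
        bounded_linear.has_derivative[OF bounded_linear_conj_cl has_derivative_q]] by blast
  have "((\<lambda>z. ?A * pv (z - w) * ?Q z) has_derivative (\<lambda>v. ?A * pv v * ?Q w)) (at w)"
    using has_derivative_clifford_mult[OF A Q'] by simp
  then have "((\<lambda>z. pv (T w) + ?A * pv (z - w) * ?Q z) has_derivative (\<lambda>v. ?A * pv v * ?Q w)) (at w)"
    using has_derivative_add[OF has_derivative_const[of "pv (T w)"]] by fastforce
  from bounded_linear.has_derivative[OF bounded_linear_adjoint_pv this]
  have *: "((\<lambda>z. adjoint pv (pv (T w) + ?A * pv (z - w) * ?Q z)) has_derivative
      (\<lambda>v. adjoint pv (?A * pv v * ?Q w))) (at w)" .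
  have "(T has_derivative (\<lambda>v. adjoint pv (?A * pv v * ?Q w))) (at w)"
  proof (rule has_derivative_transform_within_open[OF * open_D w])
    fix z assume z: "z \<in> D"
    have "pv (T w) + ?A * pv (z - w) * ?Q z = pv (T z)"
      unfolding Qw[OF z] using pv_T_diff[OF z w] by (simp add: algebra_simps)
    then show "adjoint pv (pv (T w) + ?A * pv (z - w) * ?Q z) = T z" by (simp add: adjoint_pv)
  qed
  moreover have "pv (adjoint pv (?A * pv v * ?Q w)) = ?A * pv v * inv_cl (q w)" for v
    unfolding Qw[OF w] using inverse_sandwich[OF versor_q[OF w], of v] adjoint_pv by metis
  ultimately show thesis by (rule that)
qed

lemma dilation_T:
  assumes z: "z \<in> D" shows "dilation T z = 1 / (norm (q z))\<^sup>2"
proof -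
  obtain T' where T': "(T has_derivative T') (at z)"
    "\<And>v. pv (T' v) = inv_cl (reversion (q z)) * pv v * inv_cl (q z)"
    using has_derivative_T[OF z] by blast
  have n: "norm (T' v) = 1 / (norm (q z))\<^sup>2 * norm v" for v
  proof -
    have "norm (T' v) = norm (inv_cl (reversion (q z)) * pv v * inv_cl (q z))"
      by (simp flip: T'(2))
    then show ?thesis using versor_q[OF z]
      by (simp add: versor_inv_cl versor_reversion norm_versor_mult_left norm_versor_mult_right
          norm_inv_cl power2_eq_square)
  qed
  show ?thesis unfolding dilation_def
  proof (rule the_equality)
    show "has_dilation T z (1 / (norm (q z))\<^sup>2)"
      unfolding has_dilation_def using T'(1) n z by (auto simp: D_def)
    fix \<rho> assume "has_dilation T z \<rho>"
    then obtain f' where f': "(T has_derivative f') (at z)" "\<And>v. norm (f' v) = \<rho> * norm v"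
      unfolding has_dilation_def by blast
    have "f' = T'" using f'(1) T'(1) by (rule has_derivative_unique)
    \<comment> \<open>\<open>(1, 0)\<close> is a unit vector, so evaluation there compares the two
      factors.\<close>
    then show "\<rho> = 1 / (norm (q z))\<^sup>2"
      using f'(2)[of "(1, 0)"] n[of "(1, 0)"] by (simp add: norm_Pair)
  qed
qed

text \<open>The map blows up at its pole: |p - T z| = 1 / (|c|^2 |z + x0|). A bound \<open>B\<close>
  on \<open>T\<close> over \<open>G\<close> therefore keeps \<open>G\<close> at distance at least
  \<delta> from -x0.\<close>

lemma closure_subset_D:
  assumes G: "G \<subseteq> D" and bdd: "bounded (T ` G)"
  shows "closure G \<subseteq> D"
proof (cases "c = 0")
  case True
  then obtain "versor d" using c_zero by blast
  then have "q z \<noteq> 0" for z unfolding q_def using True versor_norm(3) by simp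
  then have "D = UNIV" by (auto simp: D_def)
  then show ?thesis by simp
next
  case False
  then obtain x0 p where c: "versor c" and q: "\<And>z. q z = c * pv (z + x0)"
      and ab: "\<And>z. a * pv z + b = pv p * q z - inv_cl (reversion c)" using c_nonzero by blast
  from bdd obtain B where B: "0 < B" "\<And>z. z \<in> G \<Longrightarrow> norm (T z) \<le> B"
    by (auto simp: bounded_pos)
  define \<delta> where "\<delta> = 1 / ((B + norm p) * (norm c)\<^sup>2)"
  have nc: "0 < norm c" using versor_norm(3)[OF c] by simp
  have Bp: "0 < B + norm p" using B(1) by (simp add: add_pos_nonneg)
  have "0 < \<delta>" unfolding \<delta>_def using nc Bp by simp
  have far: "\<delta> \<le> dist z (- x0)" if z: "z \<in> G" for z
  proof -
    have zD: "z \<in> D" using z G by blast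
    have "inv_cl (reversion c) * inv_cl (q z) = pv p - pv (T z)"
      unfolding pv_T[OF zD] ab using versor_q[OF zD] by (simp add: left_diff_distrib)
    then have "norm (inv_cl (reversion c) * inv_cl (q z)) = norm (p - T z)"
      by (simp flip: pv_diff)
    then have "1 / (norm c * norm (q z)) = norm (p - T z)"
      using c versor_q[OF zD] by (simp add: versor_inv_cl versor_reversion norm_versor_mult_left norm_inv_cl)
    also have "\<dots> \<le> B + norm p" using norm_triangle_ineq4[of p "T z"] B(2)[OF z] by simp
    also have "norm (q z) = norm c * dist z (- x0)"
      unfolding q using c by (simp add: norm_versor_mult_left dist_norm)
    finally have "1 / ((norm c)\<^sup>2 * dist z (- x0)) \<le> B + norm p" by (simp add: power2_eq_square mult.assoc)
    moreover have "0 < dist z (- x0)"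
      using zD q[of z] by (auto simp: D_def dist_norm) 
    ultimately have "1 \<le> dist z (- x0) * ((B + norm p) * (norm c)\<^sup>2)"
      using nc by (simp add: pos_divide_le_eq mult_ac)
    then show ?thesis unfolding \<delta>_def using nc Bp by (subst pos_divide_le_eq) simp_all
  qed
  show ?thesis
  proof
    fix z assume "z \<in> closure G"
    have "z \<noteq> - x0"
    proof
      assume "z = - x0"
      with \<open>z \<in> closure G\<close> \<open>0 < \<delta>\<close> obtain y where "y \<in> G" "dist y (- x0) < \<delta>"
        unfolding closure_approachable by blast
      with far show False by fastforce
    qed
    then have "z + x0 \<noteq> 0" by (metis add_eq_0_iff2)
    then show "z \<in> D" using versor_norm(3)[OF versor_mult[OF c versor_pv]] by (simp add: D_def q)
  qed
qed

section \<open>The automorphy factor and the Dirac operator\<close>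

lemma versor_J: "z \<in> D \<Longrightarrow> versor (J z)"
  unfolding J_def by (intro versor_scaleR versor_conj versor_q) (auto simp: D_def)

text \<open>Up to a constant right factor \<open>J\<close> is the Cauchy kernel centred at the pole.
  The m + 1 from differentiating conj q cancels the m + 1 from differentiating the power of |q|; for
  \<open>c = 0\<close> the factor is constant.\<close>

lemma has_derivative_J:
  assumes z: "z \<in> D"
  obtains J' where "(J has_derivative J') (at z)" "(\<Sum>b\<in>Basis. pv b * J' b) = 0"
proof -
  let ?n = "CARD('m) + 1"
  have q0: "q z \<noteq> 0" using z by (simp add: D_def)
  define J' where "J' h = (1 / norm (q z) ^ ?n) *\<^sub>R conj_cl (c * pv h)
      + (- (real ?n * inner (q z) (c * pv h) / norm (q z) ^ (?n + 2))) *\<^sub>R conj_cl (q z)" for h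
  have "(J has_derivative J') (at z)"
    using has_derivative_scaleR[OF has_derivative_inverse_norm_power[OF has_derivative_q q0]
        bounded_linear.has_derivative[OF bounded_linear_conj_cl has_derivative_q], of ?n]
    unfolding J_def[abs_def] J'_def[abs_def] .
  moreover have "(\<Sum>b\<in>Basis. pv b * J' b) = 0"
  proof (cases "c = 0")
    case True
    then show ?thesis by (simp add: J'_def)
  next
    case False
    then obtain x0 where c: "versor c" and "q z = c * pv (z + x0)" by (metis c_nonzero)
    moreover define x where "x = z + x0"
    ultimately have q: "q z = c * pv x" by simp
    have nq: "norm (q z) = norm c * norm x" unfolding q using c by (simp add: norm_versor_mult_left)
    have "pv b * J' b = (1 / norm (q z) ^ ?n) *\<^sub>R (pv b * conj_cl (pv b) * conj_cl c)
        - (real ?n * (norm c)\<^sup>2 / norm (q z) ^ (?n + 2)) *\<^sub>R ((inner x b *\<^sub>R pv b) * conj_cl (q z))" for b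
      unfolding J'_def using c
      by (simp add: q inner_versor_mult_left inner_pv conj_cl_mult algebra_simps)
    then have "(\<Sum>b\<in>Basis. pv b * J' b)
      = (1 / norm (q z) ^ ?n) *\<^sub>R ((\<Sum>b\<in>Basis. pv b * conj_cl (pv b)) * conj_cl c)
        - (real ?n * (norm c)\<^sup>2 / norm (q z) ^ (?n + 2)) *\<^sub>R ((\<Sum>b\<in>Basis. inner x b *\<^sub>R pv b) * conj_cl (q z))"
      by (simp only: sum_subtractf scaleR_sum_right sum_distrib_right)
    also have "(\<Sum>b\<in>Basis. inner x b *\<^sub>R pv b) * conj_cl (q z) = (norm x)\<^sup>2 *\<^sub>R conj_cl c"
    proof -
      have "pv x * conj_cl (q z) = (pv x * conj_cl (pv x)) * conj_cl c"
        unfolding q by (simp add: conj_cl_mult mult.assoc)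
      then show ?thesis by (simp add: sum_Basis_inner_pv pv_mult_conj)
    qed
    also have "(real ?n * (norm c)\<^sup>2 / norm (q z) ^ (?n + 2)) *\<^sub>R ((norm x)\<^sup>2 *\<^sub>R conj_cl c)
        = (real ?n / norm (q z) ^ ?n) *\<^sub>R conj_cl c"
    proof -
      have "norm c \<noteq> 0" "norm x \<noteq> 0" using q0 nq by auto
      then show ?thesis by (simp add: nq power_mult_distrib power_add power2_eq_square)
    qed
    finally show ?thesis
      by (simp only: sum_Basis_pv_conj) simp
  qed
  ultimately show thesis by (rule that)
qed

text \<open>Monogenicity of \<open>J\<close> leaves only the term with the derivative of
  \<open>f\<close>. Exchanging the sums applies the adjoint of \<open>T'\<close> to the basis
  vectors and yields rev(q) k q, whose last factor meets conj q in \<open>J\<close>. The exponent is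
  4 + (m + 1) - 2 = m + 3.\<close>

lemma dirac_transport:
  assumes z: "z \<in> D" and f: "f differentiable (at (T z))"
  shows "(\<lambda>z. J z * f (T z)) differentiable (at z)"
    and "dirac (\<lambda>z. J z * f (T z)) z
      = (1 / norm (q z) ^ (CARD('m) + 3)) *\<^sub>R (reversion (q z) * dirac f (T z))"
proof -
  obtain f' where f': "(f has_derivative f') (at (T z))" using f by (auto simp: differentiable_def)
  obtain T' where T': "(T has_derivative T') (at z)"
    "\<And>v. pv (T' v) = inv_cl (reversion (q z)) * pv v * inv_cl (q z)"
    using has_derivative_T[OF z] by blast
  obtain J' where J': "(J has_derivative J') (at z)" "(\<Sum>b\<in>Basis. pv b * J' b) = 0"
    by (rule has_derivative_J[OF z])
  have vq: "versor (q z)" "versor (reversion (q z))" using versor_q[OF z] by (auto intro: versor_reversion)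
  have q0: "norm (q z) \<noteq> 0" using z by (simp add: D_def)
  have fT: "((\<lambda>z. f (T z)) has_derivative (\<lambda>h. f' (T' h))) (at z)"
    using has_derivative_compose[OF T'(1) f'] .
  have der: "((\<lambda>z. J z * f (T z)) has_derivative (\<lambda>h. J z * f' (T' h) + J' h * f (T z))) (at z)"
    by (rule has_derivative_clifford_mult[OF J'(1) fT])
  then show "(\<lambda>z. J z * f (T z)) differentiable (at z)" by (auto simp: differentiable_def)
  have lf: "linear f'" using f' by (rule has_derivative_linear)
  have "dirac (\<lambda>z. J z * f (T z)) z = (\<Sum>b\<in>Basis. pv b * (J z * f' (T' b) + J' b * f (T z)))"
    by (rule dirac_has_derivative[OF der])
  \<comment> \<open>The value \<open>f (T z)\<close> stands on the far right and leaves the second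
    sum, which is then the Dirac derivative of \<open>J\<close>.\<close>
  also have "\<dots> = (\<Sum>b\<in>Basis. pv b * J z * f' (T' b)) + (\<Sum>b\<in>Basis. pv b * J' b) * f (T z)"
    by (simp add: distrib_left sum.distrib sum_distrib_right mult.assoc)
  also have "\<dots> = (\<Sum>b\<in>Basis. pv b * J z * f' (T' b))" using J'(2) by simp
  also have "\<dots> = (\<Sum>b\<in>Basis. \<Sum>k\<in>Basis. (inner (T' b) k *\<^sub>R pv b) * (J z * f' k))"
  proof (rule sum.cong[OF refl])
    fix b :: "'m paravec"
    have "f' (T' b) = f' (\<Sum>k\<in>Basis. inner (T' b) k *\<^sub>R k)" by (simp add: euclidean_representation)
    also have "\<dots> = (\<Sum>k\<in>Basis. inner (T' b) k *\<^sub>R f' k)"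
      using lf by (simp add: linear_sum linear_scale)
    finally have *: "f' (T' b) = (\<Sum>k\<in>Basis. inner (T' b) k *\<^sub>R f' k)" .
    show "pv b * J z * f' (T' b) = (\<Sum>k\<in>Basis. (inner (T' b) k *\<^sub>R pv b) * (J z * f' k))"
      unfolding * by (simp add: sum_distrib_left mult.assoc)
  qed
  also have "\<dots> = (\<Sum>k\<in>Basis. (\<Sum>b\<in>Basis. inner (T' b) k *\<^sub>R pv b) * (J z * f' k))"
    by (subst sum.swap) (simp add: sum_distrib_right)
  also have "\<dots> = (\<Sum>k\<in>Basis. (1 / norm (q z) ^ (CARD('m) + 3)) *\<^sub>R (reversion (q z) * (pv k * f' k)))"
  proof (rule sum.cong[OF refl])
    fix k :: "'m paravec"
    \<comment> \<open>\<open>u\<close> is the preimage of \<open>k\<close> under \<open>T'\<close>.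
      As \<open>T'\<close> is a similarity of ratio |q|^-2, <T' b, k> = <T' b, T' u> = |q|^-4 <b,
      u>.\<close>
    obtain u where u: "reversion (q z) * pv k * q z = pv u"
      using versor_sandwich[OF vq(2), of k] by auto
    have "pv (T' u) = pv k"
      unfolding T'(2) u[symmetric] using vq by (simp add: mult.assoc)
    then have k: "pv k = inv_cl (reversion (q z)) * pv u * inv_cl (q z)" by (simp add: T'(2))
    have "inner (T' b) k = (1 / norm (q z) ^ 4) * inner u b" for b
    proof -
      have "inner (T' b) k = inner (pv (T' b)) (pv k)" by (simp add: inner_pv)
      also have "\<dots> = (1 / norm (q z) ^ 4) * inner u b"
        unfolding T'(2) k using vq
        by (simp add: inner_versor_mult_left inner_versor_mult_right versor_inv_cl norm_inv_cl
            inner_pv inner_commute power_divide flip: power_add)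
      finally show ?thesis .
    qed
    then have "(\<Sum>b\<in>Basis. inner (T' b) k *\<^sub>R pv b) = (1 / norm (q z) ^ 4) *\<^sub>R (\<Sum>b\<in>Basis. inner u b *\<^sub>R pv b)"
      by (simp only: scaleR_sum_right scaleR_scaleR)
    also have "(\<Sum>b\<in>Basis. inner u b *\<^sub>R pv b) = pv u" by (rule sum_Basis_inner_pv)
    finally have "(\<Sum>b\<in>Basis. inner (T' b) k *\<^sub>R pv b) * (J z * f' k)
        = (1 / norm (q z) ^ 4) *\<^sub>R pv u * (J z * f' k)" by simp
    also have "\<dots> = (1 / norm (q z) ^ 4 * (1 / norm (q z) ^ (CARD('m) + 1))) *\<^sub>R
          (reversion (q z) * pv k * (q z * conj_cl (q z)) * f' k)"
      unfolding u[symmetric] J_def by (simp add: mult.assoc)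
    also have "\<dots> = (1 / norm (q z) ^ 4 * (1 / norm (q z) ^ (CARD('m) + 1)) * (norm (q z))\<^sup>2) *\<^sub>R
          (reversion (q z) * (pv k * f' k))"
      by (simp add: versor_norm[OF vq(1)] mult.assoc)
    also have "1 / norm (q z) ^ 4 * (1 / norm (q z) ^ (CARD('m) + 1)) * (norm (q z))\<^sup>2
        = 1 / norm (q z) ^ (CARD('m) + 3)"
      using q0 by (simp add: power_add eval_nat_numeral)
    finally show "(\<Sum>b\<in>Basis. inner (T' b) k *\<^sub>R pv b) * (J z * f' k)
        = (1 / norm (q z) ^ (CARD('m) + 3)) *\<^sub>R (reversion (q z) * (pv k * f' k))" .
  qed
  also have "\<dots> = (1 / norm (q z) ^ (CARD('m) + 3)) *\<^sub>R (reversion (q z) * dirac f (T z))"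
    by (simp add: dirac_has_derivative[OF f'] sum_distrib_left scaleR_sum_right)
  finally show "dirac (\<lambda>z. J z * f (T z)) z
      = (1 / norm (q z) ^ (CARD('m) + 3)) *\<^sub>R (reversion (q z) * dirac f (T z))" .
qed

end

section \<open>Conformal change of Hausdorff measure\<close>

lemma diameter_image_le:
  assumes "bounded C" "0 \<le> L" and lip: "\<And>x y. x \<in> C \<Longrightarrow> y \<in> C \<Longrightarrow> dist (f x) (f y) \<le> L * dist x y"
  shows "bounded (f ` C)" "diameter (f ` C) \<le> L * diameter C"
proof -
  have *: "dist (f x) (f y) \<le> L * diameter C" if "x \<in> C" "y \<in> C" for x y
    using lip[OF that] mult_left_mono[OF diameter_bounded_bound[OF assms(1) that] assms(2)] by linarith
  show "bounded (f ` C)"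
    unfolding bounded_two_points using * by blast
  show "diameter (f ` C) \<le> L * diameter C"
  proof (cases "C = {}")
    case False
    then show ?thesis
      unfolding diameter_def[of "f ` C"] using * by (auto intro!: cSUP_least)
  qed simp
qed

text \<open>A cover of mesh \<delta> / L is mapped to one of mesh \<delta>, each term growing by at
  most L^k. The constant is divided over to the left so that the infimum stands alone on the
  right.\<close>

lemma hausdorff_outer_lipschitz:
  fixes f :: "'a::euclidean_space \<Rightarrow> 'b::euclidean_space"
  assumes L: "0 < L" and lip: "\<And>x y. x \<in> A \<Longrightarrow> y \<in> A \<Longrightarrow> dist (f x) (f y) \<le> L * dist x y"
  shows "hausdorff_outer k (f ` A) \<le> ennreal (L ^ k) * hausdorff_outer k A"
  unfolding hausdorff_outer_def[of k "f ` A"]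
proof (rule SUP_least)
  fix \<delta> :: real assume "\<delta> \<in> {0<..}"
  then have \<delta>: "0 < \<delta>" by simp
  have Lk: "ennreal (L ^ k) \<noteq> 0" "ennreal (L ^ k) \<noteq> top" using L by (simp_all add: ennreal_eq_0_iff not_le)
  have "hausdorff_delta k \<delta> (f ` A) / ennreal (L ^ k) \<le> hausdorff_delta k (\<delta> / L) A"
    unfolding hausdorff_delta_def[of k "\<delta> / L"]
  proof (rule INF_greatest)
    fix C :: "nat \<Rightarrow> 'a set"
    assume "C \<in> {C. A \<subseteq> (\<Union>i. C i) \<and> (\<forall>i. bounded (C i) \<and> diameter (C i) \<le> \<delta> / L)}"
    then have C: "A \<subseteq> (\<Union>i. C i)" "\<And>i. bounded (C i)" "\<And>i. diameter (C i) \<le> \<delta> / L" by auto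
    \<comment> \<open>The cover is cut down to \<open>A\<close> because the Lipschitz bound is given
      only there.\<close>
    define E where "E i = f ` (C i \<inter> A)" for i
    have CA: "bounded (C i \<inter> A)" for i using C(2) by (simp add: bounded_Int)
    have E: "bounded (E i)" "diameter (E i) \<le> L * diameter (C i)" for i
    proof -
      have "diameter (E i) \<le> L * diameter (C i \<inter> A)"
        unfolding E_def using lip L by (intro diameter_image_le CA) auto
      also have "\<dots> \<le> L * diameter (C i)"
        using L C(2) by (intro mult_left_mono diameter_subset) auto
      finally show "diameter (E i) \<le> L * diameter (C i)" .
      show "bounded (E i)"
        unfolding E_def by (rule diameter_image_le(1)[OF CA, of L]) (use lip L in auto)
    qed
    have "diameter (E i) \<le> \<delta>" for i
    proof -
      have "L * diameter (C i) \<le> L * (\<delta> / L)" using C(3) L by (intro mult_left_mono) auto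
      with E(2)[of i] L show ?thesis by simp
    qed
    moreover have "f ` A \<subseteq> (\<Union>i. E i)" using C(1) unfolding E_def by blast
    ultimately have "hausdorff_delta k \<delta> (f ` A) \<le> (\<Sum>i. hausdorff_term k (E i))"
      unfolding hausdorff_delta_def using E(1) by (intro INF_lower) auto
    also have "\<dots> \<le> (\<Sum>i. ennreal (L ^ k) * hausdorff_term k (C i))"
    proof (intro suminf_le summableI)
      fix i
      show "hausdorff_term k (E i) \<le> ennreal (L ^ k) * hausdorff_term k (C i)"
      proof (cases "E i = {}")
        case False
        then have "C i \<noteq> {}" by (auto simp: E_def)
        have "unit_ball_vol (real k) * (diameter (E i) / 2) ^ k
            \<le> unit_ball_vol (real k) * (L * diameter (C i) / 2) ^ k"
          using E[of i] by (intro mult_left_mono power_mono) (auto simp: diameter_ge_0 unit_ball_vol_nonneg)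
        also have "\<dots> = L ^ k * (unit_ball_vol (real k) * (diameter (C i) / 2) ^ k)"
          by (simp add: power_mult_distrib power_divide)
        finally show ?thesis
          using False \<open>C i \<noteq> {}\<close> L by (simp add: hausdorff_term_def ennreal_leI flip: ennreal_mult')
      qed (simp add: hausdorff_term_def)
    qed
    finally have "hausdorff_delta k \<delta> (f ` A) \<le> (\<Sum>i. hausdorff_term k (C i)) * ennreal (L ^ k)"
      by (simp add: mult.commute)
    then show "hausdorff_delta k \<delta> (f ` A) / ennreal (L ^ k) \<le> (\<Sum>i. hausdorff_term k (C i))"
      using Lk by (simp add: divide_le_posI_ennreal zero_less_iff_neq_zero mult.commute)
  qed
  also have "\<dots> \<le> hausdorff_outer k A"
    unfolding hausdorff_outer_def using \<delta> L by (intro SUP_upper) simp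
  finally have "hausdorff_delta k \<delta> (f ` A) / ennreal (L ^ k) * ennreal (L ^ k)
      \<le> hausdorff_outer k A * ennreal (L ^ k)" by (rule mult_right_mono) simp
  then show "hausdorff_delta k \<delta> (f ` A) \<le> ennreal (L ^ k) * hausdorff_outer k A"
    using Lk by (simp add: ennreal_divide_times ennreal_divide_self top.not_eq_extremum mult.commute[of "ennreal _"])
qed

text \<open>Let \<kappa> tend to 1 along 1 + 1 / (i + 1). The factor tends to 1 rather than 0, so
  the products converge even when \<open>y\<close> is infinite.\<close>

lemma ennreal_le_of_le_powers:
  fixes x y :: ennreal
  assumes "\<And>\<kappa>::real. 1 < \<kappa> \<Longrightarrow> x \<le> ennreal (\<kappa> ^ n) * y"
  shows "x \<le> y"
proof (rule LIMSEQ_le_const)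
  have "(\<lambda>i. (1 + 1 / real (Suc i)) ^ n) \<longlonglongrightarrow> (1 + 0) ^ n"
    by (intro tendsto_intros LIMSEQ_Suc lim_1_over_n)
  then have "(\<lambda>i. ennreal ((1 + 1 / real (Suc i)) ^ n)) \<longlonglongrightarrow> ennreal 1"
    by (intro tendsto_ennrealI) simp
  then show "(\<lambda>i. ennreal ((1 + 1 / real (Suc i)) ^ n) * y) \<longlonglongrightarrow> y"
    using tendsto_mult_ennreal[OF _ tendsto_const, of _ "ennreal 1" sequentially y] by simp
  show "\<exists>N. \<forall>i\<ge>N. x \<le> ennreal ((1 + 1 / real (Suc i)) ^ n) * y"
    using assms by simp
qed

text \<open>Where \<open>s\<close> lies between \<open>lo\<close> and \<open>\<kappa> * lo\<close>, the map \<open>T\<close> scales \<open>k\<close>-dimensional measure by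
  \<open>s ^ (2 * k)\<close> up to a factor \<open>\<kappa> ^ (2 * k)\<close>.  Countably many such pieces cover \<open>F\<close>;
  let \<open>\<kappa>\<close> tend to 1.\<close>

lemma hausdorff_measure_conformal:
  fixes T :: "'a::euclidean_space \<Rightarrow> 'b::euclidean_space" and s :: "'a \<Rightarrow> real"
  assumes F [measurable]: "F \<in> sets borel" and F' [measurable]: "F' \<in> sets borel"
    and T: "\<And>z. z \<in> F \<Longrightarrow> T z \<in> F'" "\<And>z. z \<in> F \<Longrightarrow> S (T z) = z" "continuous_on F T"
    and S: "\<And>w. w \<in> F' \<Longrightarrow> S w \<in> F" "\<And>w. w \<in> F' \<Longrightarrow> T (S w) = w" "continuous_on F' S"
    and s: "continuous_on F s" "\<And>z. z \<in> F \<Longrightarrow> 0 < s z"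
    and dist: "\<And>z w. z \<in> F \<Longrightarrow> w \<in> F \<Longrightarrow> dist (T z) (T w) = s z * s w * dist z w"
  shows "restrict_space (hausdorff_measure k) F' =
    distr (density (restrict_space (hausdorff_measure k) F) (\<lambda>z. ennreal (s z ^ (2 * k))))
      (restrict_space (hausdorff_measure k) F') T"
proof -
  define R where "R = restrict_space (hausdorff_measure k) F"
  define R' where "R' = restrict_space (hausdorff_measure k) F'"
  define N where "N = distr (density R (\<lambda>z. ennreal (s z ^ (2 * k)))) R' T"
  have sets_R: "sets R = sets (restrict_space borel F)" "sets R' = sets (restrict_space borel F')"
    unfolding R_def R'_def by (auto simp: sets_restrict_space sets_hausdorff_measure)
  have in_R: "A \<in> sets R \<longleftrightarrow> A \<in> sets borel \<and> A \<subseteq> F" for A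
    using F by (auto simp: sets_R sets_restrict_space_iff)
  have in_R': "A \<in> sets R' \<longleftrightarrow> A \<in> sets borel \<and> A \<subseteq> F'" for A
    using F' by (auto simp: sets_R sets_restrict_space_iff)
  have space_R: "space R = F" "space R' = F'"
    using sets_eq_imp_space_eq[OF sets_R(1)] sets_eq_imp_space_eq[OF sets_R(2)]
    by (simp_all add: space_restrict_space)
  have H: "emeasure R A = hausdorff_outer k A" if "A \<in> sets R" for A
    using that F unfolding in_R
    by (simp add: R_def emeasure_restrict_space sets_hausdorff_measure emeasure_hausdorff_measure)
  have H': "emeasure R' A = hausdorff_outer k A" if "A \<in> sets R'" for A
    using that F' unfolding in_R'
    by (simp add: R'_def emeasure_restrict_space sets_hausdorff_measure emeasure_hausdorff_measure)
  have [measurable]: "T \<in> R \<rightarrow>\<^sub>M R'"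
    unfolding measurable_cong_sets[OF sets_R]
    using T by (intro measurable_restrict_space2 borel_measurable_continuous_on_restrict) (auto simp: space_restrict_space)
  have [measurable]: "S \<in> R' \<rightarrow>\<^sub>M R"
    unfolding measurable_cong_sets[OF sets_R(2,1)]
    using S by (intro measurable_restrict_space2 borel_measurable_continuous_on_restrict) (auto simp: space_restrict_space)
  have [measurable]: "s \<in> borel_measurable R"
    unfolding measurable_cong_sets[OF sets_R(1) refl]
    using s by (intro borel_measurable_continuous_on_restrict)
  have sets_N: "sets N = sets R'" by (simp add: N_def)
  have N_eq: "emeasure N A = (\<integral>\<^sup>+z. ennreal (s z ^ (2 * k)) * indicator (S ` A) z \<partial>R)"
    and SA: "S ` A \<in> sets R" if A: "A \<in> sets R'" for A
  proof -
    have "T -` A \<inter> space R = S ` A"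
    proof
      show "T -` A \<inter> space R \<subseteq> S ` A"
        unfolding space_R by clarify (metis T(2) image_eqI)
      show "S ` A \<subseteq> T -` A \<inter> space R"
        using A S unfolding in_R' space_R by auto
    qed
    moreover have m: "T -` A \<inter> space R \<in> sets R" using A by measurable
    ultimately show "S ` A \<in> sets R" by simp
    then show "emeasure N A = (\<integral>\<^sup>+z. ennreal (s z ^ (2 * k)) * indicator (S ` A) z \<partial>R)"
      using A m \<open>T -` A \<inter> space R = S ` A\<close> unfolding N_def by (simp add: emeasure_distr emeasure_density)
  qed
  have piece: "emeasure R' A \<le> ennreal (\<kappa> ^ (2 * k)) * emeasure N A"
    "emeasure N A \<le> ennreal (\<kappa> ^ (2 * k)) * emeasure R' A"
    if A: "A \<in> sets R'" and lo: "0 < lo" and \<kappa>: "1 < \<kappa>"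
      and bd: "\<And>w. w \<in> A \<Longrightarrow> lo \<le> s (S w) \<and> s (S w) \<le> \<kappa> * lo" for A lo \<kappa>
  proof -
    have AF: "A \<subseteq> F'" using A in_R' by blast
    have TS: "T ` S ` A = A" using S(2) AF by force
    have bd': "0 \<le> s z \<and> lo \<le> s z \<and> s z \<le> \<kappa> * lo" if "z \<in> S ` A" for z
      using that bd lo by force
    have hi: "0 < \<kappa> * lo" using lo \<kappa> by simp
    have "hausdorff_outer k (T ` S ` A) \<le> ennreal (((\<kappa> * lo) ^ 2) ^ k) * hausdorff_outer k (S ` A)"
    proof (rule hausdorff_outer_lipschitz)
      show "0 < (\<kappa> * lo)\<^sup>2" using hi by (rule zero_less_power)
      fix x y assume xy: "x \<in> S ` A" "y \<in> S ` A"
      then have "x \<in> F" "y \<in> F" "s x \<le> \<kappa> * lo" "s y \<le> \<kappa> * lo" using S(1) AF bd by auto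
      then show "dist (T x) (T y) \<le> (\<kappa> * lo)\<^sup>2 * dist x y"
        unfolding dist[OF \<open>x \<in> F\<close> \<open>y \<in> F\<close>] power2_eq_square
        using s(2)[of y] hi by (intro mult_right_mono mult_mono) auto
    qed
    then have 1: "emeasure R' A \<le> ennreal ((\<kappa> * lo) ^ (2 * k)) * emeasure R (S ` A)"
      unfolding TS H[OF SA[OF A]] H'[OF A] by (simp add: power_mult)
    have "hausdorff_outer k (S ` A) \<le> ennreal ((1 / lo ^ 2) ^ k) * hausdorff_outer k A"
    proof (rule hausdorff_outer_lipschitz)
      show "0 < 1 / lo\<^sup>2" using lo by simp
      fix x y assume xy: "x \<in> A" "y \<in> A"
      then have F: "S x \<in> F" "S y \<in> F" "T (S x) = x" "T (S y) = y" "lo \<le> s (S x)" "lo \<le> s (S y)"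
        using S AF bd by auto
      have "lo\<^sup>2 * dist (S x) (S y) \<le> s (S x) * s (S y) * dist (S x) (S y)"
        unfolding power2_eq_square using F lo by (intro mult_right_mono mult_mono) auto
      also have "\<dots> = dist x y" using dist[OF F(1,2)] F by simp
      finally show "dist (S x) (S y) \<le> 1 / lo\<^sup>2 * dist x y" using lo by (simp add: field_simps)
    qed
    then have "ennreal (lo ^ (2 * k)) * emeasure R (S ` A)
        \<le> ennreal (lo ^ (2 * k)) * (ennreal ((1 / lo ^ 2) ^ k) * emeasure R' A)"
      unfolding H[OF SA[OF A]] H'[OF A] by (intro mult_left_mono) auto
    also have "\<dots> = emeasure R' A"
      using lo by (simp add: power_divide flip: mult.assoc power_mult ennreal_mult')
    finally have 2: "ennreal (lo ^ (2 * k)) * emeasure R (S ` A) \<le> emeasure R' A" .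
    have split: "ennreal ((\<kappa> * lo) ^ (2 * k)) = ennreal (\<kappa> ^ (2 * k)) * ennreal (lo ^ (2 * k))"
      using lo \<kappa> by (simp add: power_mult_distrib flip: ennreal_mult')
    have "ennreal (lo ^ (2 * k)) * emeasure R (S ` A)
        = (\<integral>\<^sup>+z. ennreal (lo ^ (2 * k)) * indicator (S ` A) z \<partial>R)"
      using SA[OF A] by (simp add: nn_integral_cmult_indicator)
    also have "\<dots> \<le> emeasure N A"
      unfolding N_eq[OF A] using bd' lo
      by (intro nn_integral_mono) (auto split: split_indicator intro!: ennreal_leI power_mono)
    finally have 3: "ennreal (lo ^ (2 * k)) * emeasure R (S ` A) \<le> emeasure N A" .
    have "emeasure N A \<le> (\<integral>\<^sup>+z. ennreal ((\<kappa> * lo) ^ (2 * k)) * indicator (S ` A) z \<partial>R)"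
      unfolding N_eq[OF A] using bd' lo
      by (intro nn_integral_mono) (auto split: split_indicator intro!: ennreal_leI power_mono)
    also have "\<dots> = ennreal ((\<kappa> * lo) ^ (2 * k)) * emeasure R (S ` A)"
      using SA[OF A] by (simp add: nn_integral_cmult_indicator)
    finally have 4: "emeasure N A \<le> ennreal ((\<kappa> * lo) ^ (2 * k)) * emeasure R (S ` A)" .
    show "emeasure R' A \<le> ennreal (\<kappa> ^ (2 * k)) * emeasure N A"
      by (rule order.trans[OF 1]) (unfold split mult.assoc, intro mult_left_mono 3, simp)
    show "emeasure N A \<le> ennreal (\<kappa> ^ (2 * k)) * emeasure R' A"
      by (rule order.trans[OF 4]) (unfold split mult.assoc, intro mult_left_mono 2, simp)
  qed
  have "emeasure R' A = emeasure N A" if A: "A \<in> sets R'" for A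
  proof -
    have both: "emeasure R' A \<le> ennreal (\<kappa> ^ (2 * k)) * emeasure N A
      \<and> emeasure N A \<le> ennreal (\<kappa> ^ (2 * k)) * emeasure R' A" if \<kappa>: "1 < \<kappa>" for \<kappa>
    proof -
      \<comment> \<open>For each integer j one piece holds the points with s in [\<kappa>^j,
        \<kappa>^(j+1)); \<open>int_decode\<close> enumerates the integers by naturals, and
        \<open>lo\<close> is \<kappa>^j.\<close>
      define B where "B n = {w \<in> space R'. \<lfloor>log \<kappa> (s (S w))\<rfloor> = int_decode n} \<inter> A" for n
      have B: "B n \<in> sets R'" for n
      proof -
        have "{w \<in> space R'. \<lfloor>log \<kappa> (s (S w))\<rfloor> = int_decode n} \<in> sets R'" by measurable
        with A show ?thesis unfolding B_def by auto
      qed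
      have disj: "disjoint_family B"
        unfolding disjoint_family_on_def B_def using inj_int_decode[of UNIV] by (auto dest: injD)
      have UN: "(\<Union>n. B n) = A"
      proof
        show "A \<subseteq> (\<Union>n. B n)"
        proof
          fix w assume "w \<in> A"
          then have "w \<in> B (int_encode \<lfloor>log \<kappa> (s (S w))\<rfloor>)"
            using A sets.sets_into_space unfolding B_def by force
          then show "w \<in> (\<Union>n. B n)" by blast
        qed
      qed (auto simp: B_def)
      have bd: "\<kappa> powr (int_decode n) \<le> s (S w) \<and> s (S w) \<le> \<kappa> * \<kappa> powr (int_decode n)"
        if "w \<in> B n" for w n
      proof -
        from that have w: "w \<in> F'" "\<lfloor>log \<kappa> (s (S w))\<rfloor> = int_decode n"
          unfolding B_def space_R by auto
        have p: "0 < s (S w)" using w S(1) s(2) by blast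
        have "real_of_int (int_decode n) \<le> log \<kappa> (s (S w))"
          "log \<kappa> (s (S w)) \<le> real_of_int (int_decode n) + 1"
          unfolding w(2)[symmetric] by linarith+
        then show ?thesis
          using \<kappa> p by (auto simp: le_log_iff log_le_iff powr_add mult.commute)
      qed
      have lo: "0 < \<kappa> powr (int_decode n)" for n using \<kappa> by simp
      have p: "emeasure R' (B n) \<le> ennreal (\<kappa> ^ (2 * k)) * emeasure N (B n)"
        "emeasure N (B n) \<le> ennreal (\<kappa> ^ (2 * k)) * emeasure R' (B n)" for n
        by (rule piece[OF B lo \<kappa> bd]; assumption)+
      have "emeasure R' A = (\<Sum>n. emeasure R' (B n))" "emeasure N A = (\<Sum>n. emeasure N (B n))"
        using suminf_emeasure[of B R', OF _ disj] suminf_emeasure[of B N, OF _ disj] B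
        by (simp_all add: UN sets_N image_subset_iff)
      then show ?thesis
        by (simp only: ennreal_suminf_cmult[symmetric]) (intro conjI suminf_le summableI p)
    qed
    show ?thesis
      by (rule antisym; rule ennreal_le_of_le_powers[of _ "2 * k"]) (use both in blast)+
  qed
  then show ?thesis
    unfolding N_def R_def R'_def by (intro measure_eqI) auto
qed

section \<open>Hardy spaces and right multiplication by versors\<close>

lemma bounded_linear_clifford_mult_left: "bounded_linear (\<lambda>x. a * x)"
  and bounded_linear_clifford_mult_right: "bounded_linear (\<lambda>x. x * a)"
  for a :: "'m::{finite,linorder} clifford"
  by (rule bounded_bilinear.bounded_linear_right[OF bounded_bilinear_clifford_mult]
      bounded_bilinear.bounded_linear_left[OF bounded_bilinear_clifford_mult])+

lemma borel_measurable_clifford_mult [measurable]: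
  fixes f g :: "'a \<Rightarrow> 'm::{finite,linorder} clifford"
  assumes "f \<in> borel_measurable M" "g \<in> borel_measurable M"
  shows "(\<lambda>x. f x * g x) \<in> borel_measurable M"
  by (rule borel_measurable_continuous_Pair[OF assms])
    (intro continuous_on_clifford_mult continuous_intros)

lemma borel_measurable_conj_cl [measurable]:
  "f \<in> borel_measurable M \<Longrightarrow> (\<lambda>x. conj_cl (f x)) \<in> borel_measurable M"
  by (rule borel_measurable_continuous_on[OF bounded_linear.continuous_on[OF bounded_linear_conj_cl]])
    (rule continuous_on_id)

text \<open>A versor is invertible, so both integrands are integrable together; otherwise both
  integrals have the default value 0.\<close>

lemma integral_versor_mult_left:
  "versor a \<Longrightarrow> (\<integral>x. a * f x \<partial>M) = a * (\<integral>x. f x \<partial>M)"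
  by (rule integral_bounded_linear'[OF bounded_linear_clifford_mult_left bounded_linear_clifford_mult_left, of _ "inv_cl a"])
    simp

lemma integral_versor_mult_right:
  "versor a \<Longrightarrow> (\<integral>x. f x * a \<partial>M) = (\<integral>x. f x \<partial>M) * a"
  by (rule integral_bounded_linear'[OF bounded_linear_clifford_mult_right bounded_linear_clifford_mult_right, of _ "inv_cl a"])
    simp

lemma sets_surface_measure: "sets (surface_measure G) = sets (restrict_space borel (frontier G))"
  unfolding surface_measure_def by (auto simp: sets_restrict_space sets_hausdorff_measure)

lemma space_surface_measure: "space (surface_measure G) = frontier G"
  using sets_eq_imp_space_eq[OF sets_surface_measure] by (simp add: space_restrict_space)

lemma measurable_surface_measure_continuous:
  "continuous_on (frontier G) f \<Longrightarrow> f \<in> borel_measurable (surface_measure G)"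
  by (subst measurable_cong_sets[OF sets_surface_measure refl])
    (rule borel_measurable_continuous_on_restrict)

lemma frontier_subset_closure: "frontier G \<subseteq> closure G"
  by (auto simp: frontier_def)

lemma dirac_mult_right:
  assumes "f differentiable (at z)"
  shows "(\<lambda>z. f z * a) differentiable (at z)" "dirac (\<lambda>z. f z * a) z = dirac f z * a"
proof -
  from assms obtain f' where f': "(f has_derivative f') (at z)" by (auto simp: differentiable_def)
  have *: "((\<lambda>z. f z * a) has_derivative (\<lambda>h. f' h * a)) (at z)"
    by (rule bounded_linear.has_derivative[OF bounded_linear_clifford_mult_right f'])
  then show "(\<lambda>z. f z * a) differentiable (at z)" by (auto simp: differentiable_def)
  show "dirac (\<lambda>z. f z * a) z = dirac f z * a"
    by (simp add: dirac_has_derivative[OF f'] dirac_has_derivative[OF *] sum_distrib_right mult.assoc)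
qed

lemma left_monogenic_mult_right: "left_monogenic G f \<Longrightarrow> left_monogenic G (\<lambda>z. f z * a)"
  unfolding left_monogenic_def by (simp add: dirac_mult_right)

lemma square_integrable_mult_right:
  "versor a \<Longrightarrow> square_integrable G f \<Longrightarrow> square_integrable G (\<lambda>z. f z * a)"
  unfolding square_integrable_def
  by (simp add: norm_versor_mult_right power_mult_distrib borel_measurable_clifford_mult)

text \<open>The Clifford-valued product becomes conj a (f, f) a, and cyclicity of \<open>Sc\<close>
  turns the outer factors into the scalar |a|^2.\<close>

lemma hardy_norm_mult_right:
  assumes "versor a"
  shows "hardy_norm G (\<lambda>z. f z * a) = norm a * hardy_norm G f"
proof -
  have "hardy_inner G (\<lambda>z. f z * a) (\<lambda>z. f z * a)
      = (\<integral>z. conj_cl a * (conj_cl (f z) * f z) * a \<partial>surface_measure G)"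
    unfolding hardy_inner_def by (simp add: conj_cl_mult mult.assoc)
  also have "\<dots> = conj_cl a * hardy_inner G f f * a"
    using assms unfolding hardy_inner_def
    by (simp add: integral_versor_mult_left integral_versor_mult_right versor_conj)
  finally have "Sc (hardy_inner G (\<lambda>z. f z * a) (\<lambda>z. f z * a)) = Sc (hardy_inner G f f * (a * conj_cl a))"
    by (metis Sc_mult_commute mult.assoc)
  then show ?thesis
    unfolding hardy_norm_def using versor_norm[OF assms] by (simp add: Sc_scaleR real_sqrt_mult)
qed

text \<open>The Dirac operator acts from the left and ignores right constants. The transported
  kernel needs this closure property, since its conjugate carries the conjugate of \<open>J'\<close>
  at the fixed point as a right factor.\<close>

lemma hardy_space_mult_right:
  assumes a: "versor a" and F: "F \<in> hardy_space G"
  shows "(\<lambda>z. F z * a) \<in> hardy_space G"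
proof -
  from F obtain f where F1: "left_monogenic G F" "square_integrable G F"
    and f: "\<And>n. f n \<in> hardy_core G" "(\<lambda>n. hardy_norm G (\<lambda>w. f n w - F w)) \<longlonglongrightarrow> 0"
      "\<And>z. z \<in> G \<Longrightarrow> (\<lambda>n. f n z) \<longlonglongrightarrow> F z"
    unfolding hardy_space_def by blast
  have "(\<lambda>w. f n w * a) \<in> hardy_core G" for n
    using f(1)[of n] a unfolding hardy_core_def
    by (auto simp: left_monogenic_mult_right square_integrable_mult_right
        intro!: continuous_on_clifford_mult)
  moreover have "(\<lambda>n. hardy_norm G (\<lambda>w. f n w * a - F w * a)) \<longlonglongrightarrow> 0"
    using tendsto_mult_right_zero[OF f(2), of "norm a"] 
    by (simp add: hardy_norm_mult_right[OF a] flip: left_diff_distrib)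
  moreover have "(\<lambda>n. f n z * a) \<longlonglongrightarrow> F z * a" if "z \<in> G" for z
    by (rule bounded_linear.tendsto[OF bounded_linear_clifford_mult_right f(3)[OF that]])
  ultimately show ?thesis
    using F1 a unfolding hardy_space_def
    by (auto simp: left_monogenic_mult_right square_integrable_mult_right intro!: exI[of _ "\<lambda>n w. f n w * a"])
qed

section \<open>Transport of Hardy spaces\<close>

text \<open>What one direction of the transport requires, free of Moebius formulas, so that the map
  with \<open>J\<close> and its inverse with \<open>J'\<close> are two instances.\<close>

locale hardy_transport =
  fixes G G' :: "'m::{finite,linorder} paravec set" and T :: "'m paravec \<Rightarrow> 'm paravec"
    and J :: "'m paravec \<Rightarrow> 'm clifford"
  assumes monogenic: "left_monogenic G' f \<Longrightarrow> left_monogenic G (\<lambda>z. J z * f (T z))"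
    and image: "T ` G \<subseteq> G'" "T ` closure G \<subseteq> closure G'" "T ` frontier G \<subseteq> frontier G'"
    and continuous: "continuous_on (closure G) T" "continuous_on (closure G) J"
    and versor: "z \<in> closure G \<Longrightarrow> versor (J z)"
    and surface: "surface_measure G' =
      distr (density (surface_measure G) (\<lambda>z. ennreal ((norm (J z))\<^sup>2))) (surface_measure G') T"
begin

abbreviation (input) V :: "('m paravec \<Rightarrow> 'm clifford) \<Rightarrow> 'm paravec \<Rightarrow> 'm clifford"
  where "V f \<equiv> \<lambda>z. J z * f (T z)"

lemma versor_frontier: "z \<in> frontier G \<Longrightarrow> versor (J z)"
  by (rule versor) (use frontier_subset_closure in blast)

lemma measurable_T [measurable]: "T \<in> surface_measure G \<rightarrow>\<^sub>M surface_measure G'"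
  unfolding measurable_cong_sets[OF sets_surface_measure sets_surface_measure]
  using image(3) continuous_on_subset[OF continuous(1) frontier_subset_closure]
  by (intro measurable_restrict_space2 borel_measurable_continuous_on_restrict)
    (auto simp: space_restrict_space)

lemma measurable_J [measurable]: "J \<in> borel_measurable (surface_measure G)"
  by (intro measurable_surface_measure_continuous continuous_on_subset[OF continuous(2)] frontier_subset_closure)

lemma
  fixes h :: "'m paravec \<Rightarrow> 'b::{banach, second_countable_topology}"
  assumes [measurable]: "h \<in> borel_measurable (surface_measure G')"
  shows integral_transport: "(\<integral>w. h w \<partial>surface_measure G')
      = (\<integral>z. (norm (J z))\<^sup>2 *\<^sub>R h (T z) \<partial>surface_measure G)"
    and integrable_transport: "integrable (surface_measure G') h
      \<longleftrightarrow> integrable (surface_measure G) (\<lambda>z. (norm (J z))\<^sup>2 *\<^sub>R h (T z))"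
  by (subst surface, subst integral_distr integrable_distr_eq,
      simp_all add: integral_density integrable_density)+

lemma square_integrable_transport:
  assumes "square_integrable G' f"
  shows "square_integrable G (V f)"
proof -
  have [measurable]: "f \<in> borel_measurable (surface_measure G')"
    using assms by (simp add: square_integrable_def)
  have "integrable (surface_measure G) (\<lambda>z. (norm (J z))\<^sup>2 *\<^sub>R (norm (f (T z)))\<^sup>2)"
    using assms by (subst integrable_transport[symmetric]) (simp_all add: square_integrable_def)
  also have "?this \<longleftrightarrow> integrable (surface_measure G) (\<lambda>z. (norm (V f z))\<^sup>2)"
    by (intro Bochner_Integration.integrable_cong refl)
      (simp add: space_surface_measure versor_frontier norm_versor_mult_left power_mult_distrib)
  finally have "integrable (surface_measure G) (\<lambda>z. (norm (V f z))\<^sup>2)" .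
  moreover have "V f \<in> borel_measurable (surface_measure G)" by measurable
  ultimately show ?thesis by (simp add: square_integrable_def)
qed

text \<open>The product conj J J in the middle is the scalar |J|^2, exactly the density of the
  change of surface measure. The Clifford-valued product itself is preserved, not only its scalar
  part.\<close>

lemma hardy_inner_transport:
  assumes [measurable]: "f \<in> borel_measurable (surface_measure G')" "g \<in> borel_measurable (surface_measure G')"
  shows "hardy_inner G (V f) (V g) = hardy_inner G' f g"
  unfolding hardy_inner_def
proof (subst integral_transport)
  show "(\<integral>z. conj_cl (V f z) * V g z \<partial>surface_measure G)
    = (\<integral>z. (norm (J z))\<^sup>2 *\<^sub>R (conj_cl (f (T z)) * g (T z)) \<partial>surface_measure G)"
  proof (rule Bochner_Integration.integral_cong[OF refl])
    fix z assume "z \<in> space (surface_measure G)"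
    then have "versor (J z)" by (simp add: space_surface_measure versor_frontier)
    have "conj_cl (V f z) * V g z = conj_cl (f (T z)) * (conj_cl (J z) * J z) * g (T z)"
      by (simp add: conj_cl_mult mult.assoc)
    then show "conj_cl (V f z) * V g z = (norm (J z))\<^sup>2 *\<^sub>R (conj_cl (f (T z)) * g (T z))"
      using versor_norm[OF \<open>versor (J z)\<close>] by simp
  qed
qed measurable

lemma hardy_core_transport:
  assumes "f \<in> hardy_core G'" shows "V f \<in> hardy_core G"
  using assms monogenic square_integrable_transport image(2) continuous
  unfolding hardy_core_def
  by (auto intro!: continuous_on_clifford_mult continuous_on_compose2[of "closure G'" f])

text \<open>An approximating sequence is transported term by term: the isometry keeps the boundary
  errors, and left multiplication by \<open>J z\<close> is continuous for the interior
  limits.\<close>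

lemma hardy_space_transport:
  assumes F: "F \<in> hardy_space G'" shows "V F \<in> hardy_space G"
proof -
  from F obtain f where F1: "left_monogenic G' F" "square_integrable G' F"
    and f: "\<And>n. f n \<in> hardy_core G'" "(\<lambda>n. hardy_norm G' (\<lambda>w. f n w - F w)) \<longlonglongrightarrow> 0"
      "\<And>z. z \<in> G' \<Longrightarrow> (\<lambda>n. f n z) \<longlonglongrightarrow> F z"
    unfolding hardy_space_def by blast
  have "hardy_norm G (\<lambda>w. V (f n) w - V F w) = hardy_norm G' (\<lambda>w. f n w - F w)" for n
  proof -
    have "(\<lambda>w. f n w - F w) \<in> borel_measurable (surface_measure G')"
      using F1(2) f(1)[of n] unfolding hardy_core_def square_integrable_def by auto
    from hardy_inner_transport[OF this this] show ?thesis
      by (simp add: hardy_norm_def algebra_simps)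
  qed
  then have "(\<lambda>n. hardy_norm G (\<lambda>w. V (f n) w - V F w)) \<longlonglongrightarrow> 0" using f(2) by simp
  moreover have "(\<lambda>n. V (f n) z) \<longlonglongrightarrow> V F z" if "z \<in> G" for z
    using f(3)[of "T z"] image(1) that
    by (intro bounded_linear.tendsto[OF bounded_linear_clifford_mult_left]) auto
  ultimately show ?thesis
    using F1 f(1) monogenic square_integrable_transport hardy_core_transport unfolding hardy_space_def
    by (auto intro!: exI[of _ "\<lambda>n. V (f n)"])
qed

end

text \<open>The relation between \<open>J'\<close> and \<open>J\<close> makes the two transport
  operators mutually inverse.\<close>

locale hardy_equivalence = hardy_transport G G' T J + inverse: hardy_transport G' G S J'
  for G G' :: "'m::{finite,linorder} paravec set" and T S J J' +
  assumes ST: "z \<in> closure G \<Longrightarrow> S (T z) = z" and TS: "w \<in> closure G' \<Longrightarrow> T (S w) = w"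
    and J'_T: "z \<in> closure G \<Longrightarrow> J' (T z) = inv_cl (J z)"
begin

lemma swap: "hardy_equivalence G' G S T J' J"
proof
  fix w assume w: "w \<in> closure G'"
  then have S: "S w \<in> closure G" using inverse.image(2) by auto
  have "inv_cl (inv_cl (J (S w))) = J (S w)" using versor[OF S] by (intro inv_cl_eqI) auto
  then show "J (S w) = inv_cl (J' w)" using J'_T[OF S] TS[OF w] by simp
qed (use ST TS in auto)

text \<open>Apply the reproducing property on \<open>G\<close> to the transport of \<open>f\<close>;
  left multiplication by \<open>J'\<close> at the target point removes the factor \<open>J z\<close>
  from the value.\<close>

lemma szego_kernel_transport:
  assumes K: "is_szego_kernel G K"
  shows "is_szego_kernel G' (\<lambda>z w. J' z * K (S z) (S w) * conj_cl (J' w))"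
  unfolding is_szego_kernel_def
proof (intro ballI conjI)
  fix z' assume z': "z' \<in> G'"
  define z where "z = S z'"
  have z: "z \<in> G" using z' inverse.image(1) by (auto simp: z_def)
  have zc: "z \<in> closure G" "z' \<in> closure G'" using z z' closure_subset by auto
  have KH: "(\<lambda>w. conj_cl (K z w)) \<in> hardy_space G"
    and rep: "\<And>f. f \<in> hardy_space G \<Longrightarrow> f z = (\<integral>w. K z w * f w \<partial>surface_measure G)"
    using K z unfolding is_szego_kernel_def by blast+
  let ?K' = "\<lambda>w. J' z' * K (S z') (S w) * conj_cl (J' w)"
  have "(\<lambda>w. J' w * conj_cl (K z (S w)) * conj_cl (J' z')) \<in> hardy_space G'"
    using inverse.hardy_space_transport[OF KH] inverse.versor[OF zc(2)]
    by (intro hardy_space_mult_right versor_conj)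
  then show H: "(\<lambda>w. conj_cl (?K' w)) \<in> hardy_space G'"
    by (simp add: conj_cl_mult mult.assoc z_def)
  fix f assume f: "f \<in> hardy_space G'"
  \<comment> \<open>Hardy membership concerns the conjugate of the kernel; conjugating back gives
    measurability of the kernel itself.\<close>
  have "(\<lambda>w. conj_cl (?K' w)) \<in> borel_measurable (surface_measure G')"
    using H unfolding hardy_space_def square_integrable_def by blast
  then have "(\<lambda>w. conj_cl (conj_cl (?K' w))) \<in> borel_measurable (surface_measure G')"
    by (rule borel_measurable_conj_cl)
  then have "?K' \<in> borel_measurable (surface_measure G')" by simp
  moreover have "f \<in> borel_measurable (surface_measure G')"
    using f unfolding hardy_space_def square_integrable_def by blast
  ultimately have m: "(\<lambda>w. ?K' w * f w) \<in> borel_measurable (surface_measure G')" by measurable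
  have "(\<integral>w. ?K' w * f w \<partial>surface_measure G')
      = (\<integral>w. (norm (J w))\<^sup>2 *\<^sub>R (?K' (T w) * f (T w)) \<partial>surface_measure G)"
    by (rule integral_transport[OF m])
  also have "\<dots> = (\<integral>w. J' z' * (K z w * (J w * f (T w))) \<partial>surface_measure G)"
  proof (rule Bochner_Integration.integral_cong[OF refl])
    fix w assume "w \<in> space (surface_measure G)"
    then have w: "w \<in> closure G" using frontier_subset_closure by (auto simp: space_surface_measure)
    note v = versor[OF w]
    \<comment> \<open>Since J' (T w) = conj (J w) / |J w|^2, the weight |J|^2 turns its conjugate
      into the factor \<open>J w\<close> of the transported \<open>f\<close>.\<close>
    have "(norm (J w))\<^sup>2 *\<^sub>R conj_cl (J' (T w)) = J w"
      using versor_norm(3)[OF v] by (simp add: J'_T[OF w] inv_cl_versor[OF v] conj_cl_linear)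
    moreover have "(norm (J w))\<^sup>2 *\<^sub>R (?K' (T w) * f (T w))
        = J' z' * K z w * ((norm (J w))\<^sup>2 *\<^sub>R conj_cl (J' (T w))) * f (T w)"
      by (simp add: ST[OF w] z_def)
    ultimately show "(norm (J w))\<^sup>2 *\<^sub>R (?K' (T w) * f (T w)) = J' z' * (K z w * (J w * f (T w)))"
      by (simp add: mult.assoc)
  qed
  also have "\<dots> = J' z' * (\<integral>w. K z w * (J w * f (T w)) \<partial>surface_measure G)"
    by (rule integral_versor_mult_left[OF inverse.versor[OF zc(2)]])
  also have "\<dots> = J' z' * (J z * f (T z))"
    using rep[OF hardy_space_transport[OF f]] by simp
  also have "\<dots> = f z'"
    using J'_T[OF zc(1)] versor[OF zc(1)] TS[OF zc(2)] by (simp add: z_def)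
  finally show "f z' = (\<integral>w. ?K' w * f w \<partial>surface_measure G')" ..
qed

text \<open>\<open>szego_kernel\<close> is a choice, so uniqueness identifies the chosen kernel of
  \<open>G'\<close> with the transported one; on the diagonal cyclicity of \<open>Sc\<close> brings
  the two outer factors together.\<close>

lemma szego_metric_transport:
  assumes z: "z \<in> G"
  shows "szego_metric G z = (norm (J z))\<^sup>2 * szego_metric G' (T z)"
proof (cases "\<exists>K. is_szego_kernel G K")
  case True
  then have K: "is_szego_kernel G (szego_kernel G)"
    unfolding szego_kernel_def by (simp add: someI_ex)
  have zc: "z \<in> closure G" using z closure_subset by auto
  have Tz: "T z \<in> G'" using z image(1) by auto
  note K' = szego_kernel_transport[OF K]
  then have "is_szego_kernel G' (szego_kernel G')"
    unfolding szego_kernel_def[of G'] by (auto simp: someI)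
  from szego_kernel_unique[OF this K' Tz Tz]
  have "szego_kernel G' (T z) (T z) = J' (T z) * szego_kernel G z z * conj_cl (J' (T z))"
    by (simp add: ST[OF zc])
  then have "szego_metric G' (T z) = Sc (szego_kernel G z z * (conj_cl (J' (T z)) * J' (T z)))"
    unfolding szego_metric_def by (metis Sc_mult_commute mult.assoc)
  also have "\<dots> = (norm (inv_cl (J z)))\<^sup>2 * szego_metric G z"
    using versor_norm(2)[OF versor_inv_cl[OF versor[OF zc]]]
    by (simp add: J'_T[OF zc] Sc_scaleR szego_metric_def)
  finally show ?thesis
    using versor_norm(3)[OF versor[OF zc]] by (simp add: norm_inv_cl versor[OF zc] power_divide)
next
  case False
  \<comment> \<open>The kernel transports in both directions, so neither domain has one and both metrics are the
    conventional 0.\<close>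
  interpret swap: hardy_equivalence G' G S T J' J by (rule swap)
  have "\<not> (\<exists>K. is_szego_kernel G' K)"
    using False swap.szego_kernel_transport by blast
  with False show ?thesis by (simp add: szego_metric_def szego_kernel_def Sc_def)
qed

end

section \<open>The isometry induced by a Moebius transformation\<close>

context moebius
begin

text \<open>The conjugate of \<open>q\<close> absorbs one of the m + 1 powers. Hence |J|^2 = s^(2m)
  for s = 1 / |q|, the density matching m-dimensional measure.\<close>

lemma norm_J: "norm (J z) = (1 / norm (q z)) ^ CARD('m)"
  by (cases "q z = 0") (simp_all add: J_def power_divide power_0_left)

lemma inj_on_T: "inj_on T D"
proof (rule inj_onI)
  fix z w assume "z \<in> D" "w \<in> D" "T z = T w"
  then show "z = w" using dist_T[of z w] by (auto simp: D_def)
qed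

text \<open>Inverted on the closure because boundary values are transported as well.\<close>

definition S :: "'m paravec set \<Rightarrow> 'm paravec \<Rightarrow> 'm paravec"
  where "S G = the_inv_into (closure G) T"

text \<open>The inverse of \<open>J\<close> at \<open>S G w\<close>: conj J / |J|^2 = |q|^(m-1) q.
  The subtraction is genuine since m is at least 1.\<close>

definition J' :: "'m paravec set \<Rightarrow> 'm paravec \<Rightarrow> 'm clifford"
  where "J' G w = norm (q (S G w)) ^ (CARD('m) - 1) *\<^sub>R q (S G w)"

context
  fixes G :: "'m paravec set"
  assumes open_G: "open G" and bounded_G: "bounded G" and G_subset: "G \<subseteq> D"
    and open_TG: "open (T ` G)" and bounded_TG: "bounded (T ` G)"
begin

section \<open>The inverse map on the closed domain\<close>

lemma closure_G_subset: "closure G \<subseteq> D"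
  by (rule closure_subset_D[OF G_subset bounded_TG])

lemma inj_on_closure: "inj_on T (closure G)"
  by (rule inj_on_subset[OF inj_on_T closure_G_subset])

lemma continuous_on_T_closure: "continuous_on (closure G) T"
  by (rule continuous_on_subset[OF continuous_on_T closure_G_subset])

lemma S_T: "z \<in> closure G \<Longrightarrow> S G (T z) = z"
  unfolding S_def by (rule the_inv_into_f_f[OF inj_on_closure])

lemma T_closure: "T ` closure G = closure (T ` G)"
proof
  show "T ` closure G \<subseteq> closure (T ` G)"
    by (rule image_closure_subset[OF continuous_on_T_closure]) (auto simp: closure_subset)
  show "closure (T ` G) \<subseteq> T ` closure G"
    using bounded_G by (intro closure_minimal image_mono closure_subset compact_imp_closed
        compact_continuous_image[OF continuous_on_T_closure]) (simp add: compact_closure)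
qed

text \<open>Both sets are open, so each frontier is the closure minus the set; injectivity on the
  closure lets \<open>T\<close> commute with that difference.\<close>

lemma T_frontier: "T ` frontier G = frontier (T ` G)"
  unfolding frontier_def interior_open[OF open_G] interior_open[OF open_TG] T_closure[symmetric]
  using inj_on_image_set_diff[OF inj_on_closure _ closure_subset, of "closure G"] by simp

lemma T_S: "w \<in> closure (T ` G) \<Longrightarrow> T (S G w) = w"
  and S_closure: "w \<in> closure (T ` G) \<Longrightarrow> S G w \<in> closure G"
  and S_frontier: "w \<in> frontier (T ` G) \<Longrightarrow> S G w \<in> frontier G"
  and S_interior: "w \<in> T ` G \<Longrightarrow> S G w \<in> G"
proof -
  show "w \<in> closure (T ` G) \<Longrightarrow> T (S G w) = w" "w \<in> closure (T ` G) \<Longrightarrow> S G w \<in> closure G"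
    unfolding T_closure[symmetric] by (auto simp only: S_T)
  show "w \<in> frontier (T ` G) \<Longrightarrow> S G w \<in> frontier G"
    unfolding T_frontier[symmetric] using frontier_subset_closure[of G] S_T by force
  show "w \<in> T ` G \<Longrightarrow> S G w \<in> G"
    using closure_subset[of G] S_T by force
qed

lemma continuous_on_S: "continuous_on (closure (T ` G)) (S G)"
  unfolding T_closure[symmetric] S_def
  by (rule continuous_on_inv_into[OF continuous_on_T_closure _ inj_on_closure])
    (simp add: bounded_G compact_closure)

lemma D_closure: "z \<in> closure G \<Longrightarrow> z \<in> D" and D_S: "w \<in> closure (T ` G) \<Longrightarrow> S G w \<in> D"
  using closure_G_subset S_closure by blast+

lemma J'_T: assumes "z \<in> closure G" shows "J' G (T z) = inv_cl (J z)"
proof -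
  note z = D_closure[OF assms]
  note v = versor_q[OF z]
  have n: "norm (q z) \<noteq> 0" using z by (simp add: D_def)
  obtain m where m: "CARD('m) = Suc m" 
    using gr0_implies_Suc[OF zero_less_card_finite] by blast
  show ?thesis
    unfolding J'_def J_def S_T[OF assms] m using n
    by (intro inv_cl_eqI[symmetric]) (simp_all add: versor_norm[OF v] power2_eq_square)
qed

lemma norm_J': "norm (J' G w) = norm (q (S G w)) ^ CARD('m)"
proof -
  obtain m where m: "CARD('m) = Suc m"
    using gr0_implies_Suc[OF zero_less_card_finite] by blast
  show ?thesis unfolding J'_def m by (simp add: mult.commute)
qed

text \<open>The candidate derivative v -> rev(q) v q undoes the sandwich by which \<open>T\<close>
  differentiates; continuity of the inverse comes from compactness of the closure.\<close>

lemma has_derivative_S: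
  assumes z: "z \<in> G"
  shows "\<exists>S'. (S G has_derivative S') (at (T z))"
proof -
  have zc: "z \<in> closure G" using z closure_subset by blast
  obtain T' where T': "(T has_derivative T') (at z)"
    "\<And>v. pv (T' v) = inv_cl (reversion (q z)) * pv v * inv_cl (q z)"
    using has_derivative_T[OF D_closure[OF zc]] by blast
  have v: "versor (q z)" "versor (reversion (q z))"
    using versor_q[OF D_closure[OF zc]] by (auto intro: versor_reversion)
  let ?S' = "\<lambda>v. adjoint pv (reversion (q z) * pv v * q z)"
  have "(S G has_derivative ?S') (at (T z))"
  proof (rule has_derivative_inverse_basic)
    show "(T has_derivative T') (at (S G (T z)))" using T'(1) S_T[OF zc] by simp
    show "bounded_linear ?S'"
      by (rule bounded_linear_compose[OF bounded_linear_adjoint_pv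
          bounded_linear_compose[OF bounded_linear_clifford_mult_right
            bounded_linear_compose[OF bounded_linear_clifford_mult_left bounded_linear_pv]]])
    have "?S' (T' u) = u" for u
    proof -
      have "reversion (q z) * pv (T' u) * q z = pv u"
        unfolding T'(2) using v by (simp add: mult.assoc)
      then show ?thesis by (simp add: adjoint_pv)
    qed
    then show "?S' \<circ> T' = id" by (simp add: fun_eq_iff)
    have "continuous_on (T ` G) (S G)"
      by (rule continuous_on_subset[OF continuous_on_S closure_subset])
    then show "continuous (at (T z)) (S G)"
      by (rule continuous_on_eq_continuous_at[OF open_TG, THEN iffD1, THEN bspec]) (rule imageI[OF z])
    show "T (S G w) = w" if "w \<in> T ` G" for w
      by (rule T_S[OF subsetD[OF closure_subset that]])
    show "open (T ` G)" by (rule open_TG)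
    show "T z \<in> T ` G" by (rule imageI[OF z])
  qed
  then show ?thesis by blast
qed

lemma has_derivative_J':
  assumes z: "z \<in> G"
  shows "\<exists>F. (J' G has_derivative F) (at (T z))"
proof -
  have zc: "z \<in> closure G" using z closure_subset by blast
  obtain S' where S': "(S G has_derivative S') (at (T z))" using has_derivative_S[OF z] by blast
  have qS: "((\<lambda>w. q (S G w)) has_derivative (\<lambda>h. c * pv (S' h))) (at (T z))"
    using has_derivative_compose[OF S' has_derivative_q] .
  have "q (S G (T z)) \<noteq> 0" using D_closure[OF zc] S_T[OF zc] by (simp add: D_def)
  from has_derivative_compose[OF qS has_derivative_norm[OF this]]
  show ?thesis
    unfolding J'_def[abs_def] using has_derivative_scaleR[OF has_derivative_power qS] by blast
qed

text \<open>No Dirac derivative of \<open>J'\<close> is computed. The transported function f is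
  differentiable, and J f(T) = g on \<open>G\<close>; \<open>dirac_transport\<close> makes D g a
  multiple of rev(q) (D f)(T), and rev(q) cancels.\<close>

lemma left_monogenic_inverse:
  assumes g: "left_monogenic G g"
  shows "left_monogenic (T ` G) (\<lambda>w. J' G w * g (S G w))"
  unfolding left_monogenic_def
proof (intro ballI conjI)
  fix w assume "w \<in> T ` G"
  then obtain z where z: "z \<in> G" and w: "w = T z" by (rule imageE)
  have zc: "z \<in> closure G" using z closure_subset by blast
  note zD = D_closure[OF zc]
  let ?f = "\<lambda>w. J' G w * g (S G w)"
  obtain S' F where S': "(S G has_derivative S') (at (T z))" and F: "(J' G has_derivative F) (at (T z))"
    using has_derivative_S[OF z] has_derivative_J'[OF z] by blast
  obtain g' where g': "(g has_derivative g') (at (S G (T z)))"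
    using g z S_T[OF zc] by (auto simp: left_monogenic_def differentiable_def)
  from has_derivative_clifford_mult[OF F has_derivative_compose[OF S' g']]
  have d: "?f differentiable (at (T z))" by (rule differentiableI)
  then show "?f differentiable (at w)" unfolding w .
  have eq: "J u * ?f (T u) = g u" if "u \<in> G" for u
  proof -
    have u: "u \<in> closure G" using that closure_subset by blast
    then show ?thesis using versor_J[OF D_closure[OF u]] by (simp add: J'_T S_T)
  qed
  obtain h where h: "((\<lambda>u. J u * ?f (T u)) has_derivative h) (at z)"
    using dirac_transport(1)[OF zD d] by (auto simp: differentiable_def)
  have "(g has_derivative h) (at z)"
    by (rule has_derivative_transform_within_open[OF h open_G z eq])
  with h have "dirac (\<lambda>u. J u * ?f (T u)) z = dirac g z"
    by (simp only: dirac_has_derivative)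
  also have "\<dots> = 0" using g z by (simp add: left_monogenic_def)
  finally have "(1 / norm (q z) ^ (CARD('m) + 3)) *\<^sub>R (reversion (q z) * dirac ?f (T z)) = 0"
    unfolding dirac_transport(2)[OF zD d] .
  then have "reversion (q z) * dirac ?f (T z) = 0" using zD by (simp add: D_def)
  then have "inv_cl (reversion (q z)) * (reversion (q z) * dirac ?f (T z)) = 0" by simp
  then show "dirac ?f w = 0" unfolding w using versor_reversion[OF versor_q[OF zD]] by simp
qed

section \<open>Surface measure under the map and its inverse\<close>

lemma surface_measure_T: "surface_measure (T ` G) =
  distr (density (surface_measure G) (\<lambda>z. ennreal ((norm (J z))\<^sup>2))) (surface_measure (T ` G)) T"
proof -
  have F: "frontier G \<subseteq> D" using frontier_subset_closure closure_G_subset by blast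
  have "restrict_space (hausdorff_measure CARD('m)) (frontier (T ` G)) =
    distr (density (restrict_space (hausdorff_measure CARD('m)) (frontier G))
        (\<lambda>z. ennreal ((1 / norm (q z)) ^ (2 * CARD('m)))))
      (restrict_space (hausdorff_measure CARD('m)) (frontier (T ` G))) T"
  proof (rule hausdorff_measure_conformal[where S = "S G"])
    show "continuous_on (frontier G) T" by (rule continuous_on_subset[OF continuous_on_T F])
    show "continuous_on (frontier (T ` G)) (S G)"
      by (rule continuous_on_subset[OF continuous_on_S frontier_subset_closure])
    show "continuous_on (frontier G) (\<lambda>z. 1 / norm (q z))"
      using F by (intro continuous_intros continuous_on_q) (auto simp: D_def)
    show "z \<in> frontier G \<Longrightarrow> T z \<in> frontier (T ` G)" for z
      unfolding T_frontier[symmetric] by (rule imageI)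
    show "z \<in> frontier G \<Longrightarrow> 0 < 1 / norm (q z)" for z using F by (auto simp: D_def)
    show "\<lbrakk>z \<in> frontier G; w \<in> frontier G\<rbrakk>
      \<Longrightarrow> dist (T z) (T w) = 1 / norm (q z) * (1 / norm (q w)) * dist z w" for z w
      using F by (intro dist_T) blast+
    show "z \<in> frontier G \<Longrightarrow> S G (T z) = z" for z
      using frontier_subset_closure by (intro S_T) blast
    show "w \<in> frontier (T ` G) \<Longrightarrow> T (S G w) = w" for w
      using frontier_subset_closure by (intro T_S) blast
  qed (simp_all add: S_frontier)
  then show ?thesis
    unfolding surface_measure_def norm_J by (simp only: power_mult[symmetric] mult.commute[of 2])
qed

text \<open>The conformal change of measure with the roles exchanged: solving \<open>dist_T\<close>
  for the distance in \<open>G\<close> gives the scale |q (S w)|.\<close>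

lemma surface_measure_S: "surface_measure G =
  distr (density (surface_measure (T ` G)) (\<lambda>w. ennreal ((norm (J' G w))\<^sup>2))) (surface_measure G) (S G)"
proof -
  have F: "frontier G \<subseteq> D" using frontier_subset_closure closure_G_subset by blast
  have fc: "w \<in> frontier (T ` G) \<Longrightarrow> w \<in> closure (T ` G)" for w
    using frontier_subset_closure by blast
  have "restrict_space (hausdorff_measure CARD('m)) (frontier G) =
    distr (density (restrict_space (hausdorff_measure CARD('m)) (frontier (T ` G)))
        (\<lambda>w. ennreal (norm (q (S G w)) ^ (2 * CARD('m)))))
      (restrict_space (hausdorff_measure CARD('m)) (frontier G)) (S G)"
  proof (rule hausdorff_measure_conformal[where S = T])
    show "continuous_on (frontier G) T" by (rule continuous_on_subset[OF continuous_on_T F])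
    show S: "continuous_on (frontier (T ` G)) (S G)"
      by (rule continuous_on_subset[OF continuous_on_S frontier_subset_closure])
    show "continuous_on (frontier (T ` G)) (\<lambda>w. norm (q (S G w)))"
      by (intro continuous_intros continuous_on_compose2[OF continuous_on_q S]) auto
    show "z \<in> frontier G \<Longrightarrow> T z \<in> frontier (T ` G)" for z
      unfolding T_frontier[symmetric] by (rule imageI)
    show "w \<in> frontier (T ` G) \<Longrightarrow> 0 < norm (q (S G w))" for w
      using D_S[OF fc] by (simp add: D_def)
    show "dist (S G w) (S G w') = norm (q (S G w)) * norm (q (S G w')) * dist w w'"
      if "w \<in> frontier (T ` G)" "w' \<in> frontier (T ` G)" for w w'
      using dist_T[OF D_S[OF fc[OF that(1)]] D_S[OF fc[OF that(2)]]]
        D_S[OF fc[OF that(1)]] D_S[OF fc[OF that(2)]]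
      by (simp add: T_S fc that D_def)
    show "z \<in> frontier G \<Longrightarrow> S G (T z) = z" for z
      using frontier_subset_closure by (intro S_T) blast
    show "w \<in> frontier (T ` G) \<Longrightarrow> T (S G w) = w" for w
      by (intro T_S fc)
  qed (simp_all add: S_frontier)
  then show ?thesis
    unfolding surface_measure_def norm_J' by (simp only: power_mult[symmetric] mult.commute[of 2])
qed

lemma hardy_equivalence_T: "hardy_equivalence G (T ` G) T (S G) J (J' G)"
proof unfold_locales
  show "left_monogenic G (\<lambda>z. J z * f (T z))" if f: "left_monogenic (T ` G) f" for f
    unfolding left_monogenic_def
  proof
    fix z assume z: "z \<in> G"
    then have "f differentiable (at (T z))" "dirac f (T z) = 0"
      using f by (auto simp: left_monogenic_def)
    then show "(\<lambda>z. J z * f (T z)) differentiable (at z) \<and> dirac (\<lambda>z. J z * f (T z)) z = 0"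
      using dirac_transport[OF subsetD[OF G_subset z], of f] by simp
  qed
  show "T ` closure G \<subseteq> closure (T ` G)" "T ` frontier G \<subseteq> frontier (T ` G)"
    by (simp_all add: T_closure T_frontier)
  show "continuous_on (closure G) T" by (rule continuous_on_T_closure)
  show "continuous_on (closure G) J" by (rule continuous_on_subset[OF continuous_on_J closure_G_subset])
  show "z \<in> closure G \<Longrightarrow> versor (J z)" for z by (intro versor_J D_closure)
  show "surface_measure (T ` G) =
      distr (density (surface_measure G) (\<lambda>z. ennreal ((norm (J z))\<^sup>2))) (surface_measure (T ` G)) T"
    by (rule surface_measure_T)
  show "left_monogenic G f \<Longrightarrow> left_monogenic (T ` G) (\<lambda>z. J' G z * f (S G z))" for f
    by (rule left_monogenic_inverse)
  show "S G ` T ` G \<subseteq> G" "S G ` closure (T ` G) \<subseteq> closure G" "S G ` frontier (T ` G) \<subseteq> frontier G"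
    using S_interior S_closure S_frontier by blast+
  show "continuous_on (closure (T ` G)) (S G)" by (rule continuous_on_S)
  show "continuous_on (closure (T ` G)) (J' G)"
    unfolding J'_def[abs_def]
    by (intro continuous_intros continuous_on_compose2[OF continuous_on_q continuous_on_S]) auto
  show "versor (J' G w)" if "w \<in> closure (T ` G)" for w
    unfolding J'_def using D_S[OF that] by (intro versor_scaleR versor_q) (auto simp: D_def)
  show "surface_measure G =
      distr (density (surface_measure (T ` G)) (\<lambda>w. ennreal ((norm (J' G w))\<^sup>2))) (surface_measure G) (S G)"
    by (rule surface_measure_S)
qed (auto simp: S_T T_S J'_T)

end

end

theorem theorem2:
  fixes G :: "'m::{finite,linorder} paravec set"
    and a b c d :: "'m clifford"
  assumes "smooth_bounded_domain G"
    and "moebius_coeffs a b c d"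
    and "\<forall>z\<in>G. invertible_cl (c * pv z + d)"
    and "conformal_on G (moebius_map a b c d)"
    and "smooth_bounded_domain (moebius_map a b c d ` G)"
  shows "\<forall>z\<in>G.
    szego_metric (moebius_map a b c d ` G) (moebius_map a b c d z) * dilation (moebius_map a b c d) z
    = norm (c * pv z + d) ^ (2 * CARD('m) - 2) * szego_metric G z"
proof
  fix z assume z: "z \<in> G"
  interpret moebius a b c d by standard (rule assms(2))
  have GD: "G \<subseteq> D" using assms(3) unfolding D_iff[abs_def] q_def by (auto simp: D_iff q_def)
  have "hardy_equivalence G (T ` G) T (S G) J (J' G)"
    using assms(1,5) GD by (intro hardy_equivalence_T) (auto simp: smooth_bounded_domain_def)
  from hardy_equivalence.szego_metric_transport[OF this z]
  have eq: "szego_metric G z = (1 / norm (q z)) ^ (2 * CARD('m)) * szego_metric (T ` G) (T z)"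
    by (simp add: norm_J flip: power_mult) (simp add: mult.commute)
  have zD: "z \<in> D" using z GD by blast
  have n: "norm (q z) \<noteq> 0" using zD by (simp add: D_def)
  \<comment> \<open>Writing m as a successor makes the truncated \<open>2 * m - 2\<close> a true
    exponent. Then |q|^-2 from the dilation equals |q|^(2m-2) times |q|^(-2m) from the
    transport.\<close>
  obtain m where m: "CARD('m) = Suc m" 
    using gr0_implies_Suc[OF zero_less_card_finite] by blast
  show "szego_metric (T ` G) (T z) * dilation T z = norm (c * pv z + d) ^ (2 * CARD('m) - 2) * szego_metric G z"
    unfolding eq dilation_T[OF zD] q_def[symmetric] m using n
    by (simp add: power_divide power_add power2_eq_square)
qed

end
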